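(* Suppose that the random measure $G$ satisfies the Ghirlanda-Guerra identities. Let $n\geq 1$, let $f_1,\ldots,f_n:\mathbb{R}^{n(n-1)/2}\times\mathbb{R}\to\mathbb{R}$ be bounded measurable functions, and let $\bar F$ be defined from them as in the context. Then with probability one over the choice of the measure $G$ and for $G^{\otimes n}$-almost all $(\sigma^1,\ldots,\sigma^n)$, the $G$-measures of the sets $$\{\sigma : \bar{F}(\sigma,\sigma^1,\ldots,\sigma^n) > 0\}\quad\text{and}\quad \{\sigma : \bar{F}(\sigma,\sigma^1,\ldots,\sigma^n) < 0\}$$ are either both positive or both equal to zero. In particular, the inequalities $\bar F\geq 0$ and $\bar F\leq 0$ each hold on a set (of $\sigma$) of positive $G$-measure.
   Context: $G$ is a random probability measure on the unit ball of a separable Hilbert space $H$; $(\sigma^l)_{l\geq 1}$ is an i.i.d. sequence from $G$; $\langle\cdot\rangle$ is the average with respect to $G^{\otimes\infty}$; $\mathbb{E}$ is the expectation with respect to the randomness of $G$. $R_{l,l'}=\sigma^l\cdot\sigma^{l'}$ is the scalar product (overlap), $R^n=(R_{l,l'})_{l<l'\leq n}$, and $\mu$ is the law of $R_{1,2}$ under $\mathbb{E}G^{\otimes 2}$. Ghirlanda-Guerra identities: for any $n\geq 2$, any bounded measurable function $f$ of the overlaps $(R_{l,l'})_{l,l'\leq n}$ and any bounded measurable function $\psi$ of one overlap, $$\mathbb{E}\langle f\psi(R_{1,n+1})\rangle=\frac1n\,\mathbb{E}\langle f\rangle\,\mathbb{E}\langle\psi(R_{1,2})\rangle+\frac1n\sum_{l=2}^n\mathbb{E}\langle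 f\psi(R_{1,l})\rangle .$$ Definitions: $$F(\sigma,\sigma^1,\ldots,\sigma^n)=f_1(R^n,\sigma\cdot\sigma^1)+\ldots+f_n(R^n,\sigma\cdot\sigma^n),$$ for $1\leq l\leq n$, $$F_l(\sigma,\sigma^1,\ldots,\sigma^n)=F(\sigma,\sigma^1,\ldots,\sigma^n)-f_l(R^n,\sigma\cdot\sigma^l)+\int f_l(R^n,x)\,d\mu(x),$$ and $$\bar{F}(\sigma,\sigma^1,\ldots,\sigma^n)=F(\sigma,\sigma^1,\ldots,\sigma^n)-\frac{1}{n}\sum_{l=1}^{n}F_l(\sigma^l,\sigma^1,\ldots,\sigma^n).$$ *)

theory Defs
  imports "HOL-Probability.Probability"
begin

text \<open>
  The separable Hilbert space \<open>H\<close> is a type \<open>'h\<close> of sort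
  \<open>{real_inner, complete_space, second_countable_topology}\<close> (second countability and
  separability agree for metric spaces). The underlying probability space is \<open>P\<close>, and a random
  measure is a map \<open>G\<close> from its sample space to measures on \<open>'h\<close>.
\<close>

definition unit_ball_borel :: "'h::real_inner measure" where
  "unit_ball_borel = restrict_space borel (cball 0 1)"

definition random_prob_measure :: "'w measure \<Rightarrow> ('w \<Rightarrow> 'h::real_inner measure) \<Rightarrow> bool" where
  "random_prob_measure P G \<longleftrightarrow> prob_space P \<and> G \<in> P \<rightarrow>\<^sub>M prob_algebra unit_ball_borel"

definition bounded_measurable :: "'a measure \<Rightarrow> ('a \<Rightarrow> real) \<Rightarrow> bool" where
  "bounded_measurable M f \<longleftrightarrow> f \<in> borel_measurable M \<and> bounded (f ` space M)"

text \<open>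
  The annealed average \<open>\<bbbE>\<langle>\<phi>\<rangle>\<close> of a function of the replicas \<open>\<sigma>\<^sup>1, \<sigma>\<^sup>2, \<dots>\<close>. Replicas are numbered
  from 1, so a configuration is a function \<open>s\<close> on \<open>{1..}\<close>.
\<close>

definition annealed ::
  "'w measure \<Rightarrow> ('w \<Rightarrow> 'h measure) \<Rightarrow> ((nat \<Rightarrow> 'h) \<Rightarrow> real) \<Rightarrow> real" where
  "annealed P G \<phi> = (\<integral>w. (\<integral>s. \<phi> s \<partial>(\<Pi>\<^sub>M i\<in>{1..}. G w)) \<partial>P)"

definition overlap :: "(nat \<Rightarrow> 'h::real_inner) \<Rightarrow> nat \<Rightarrow> nat \<Rightarrow> real" where
  "overlap s l l' = s l \<bullet> s l'"

definition overlap_array :: "(nat \<times> nat) set \<Rightarrow> (nat \<Rightarrow> 'h::real_inner) \<Rightarrow> nat \<times> nat \<Rightarrow> real" where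
  "overlap_array I s = restrict (\<lambda>(l, l'). overlap s l l') I"

abbreviation real_arrays :: "(nat \<times> nat) set \<Rightarrow> (nat \<times> nat \<Rightarrow> real) measure" where
  "real_arrays I \<equiv> (\<Pi>\<^sub>M p\<in>I. borel)"

text \<open>
  The test function \<open>f\<close> depends on the full array of overlaps among the first \<open>n\<close> replicas, that
  is, including the self-overlaps on the diagonal.
\<close>

definition ghirlanda_guerra :: "'w measure \<Rightarrow> ('w \<Rightarrow> 'h::real_inner measure) \<Rightarrow> bool" where
  "ghirlanda_guerra P G \<longleftrightarrow>
    (\<forall>n\<ge>2. \<forall>f \<psi>.
      bounded_measurable (real_arrays ({1..n} \<times> {1..n})) f \<longrightarrow> bounded_measurable borel \<psi> \<longrightarrow>
      annealed P G (\<lambda>s. f (overlap_array ({1..n} \<times> {1..n}) s) * \<psi> (overlap s 1 (n + 1))) =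
        1 / real n * annealed P G (\<lambda>s. f (overlap_array ({1..n} \<times> {1..n}) s))
                   * annealed P G (\<lambda>s. \<psi> (overlap s 1 2))
        + 1 / real n * (\<Sum>l = 2..n.
            annealed P G (\<lambda>s. f (overlap_array ({1..n} \<times> {1..n}) s) * \<psi> (overlap s 1 l))))"

text \<open>
  \<open>\<bbbE>G\<^sup>\<otimes>\<^sup>2\<close> is the mixture of \<open>G w \<Otimes>\<^sub>M G w\<close> over \<open>P\<close>, and \<open>\<mu>\<close> is the law of the scalar product
  under it.
\<close>

definition overlap_law :: "'w measure \<Rightarrow> ('w \<Rightarrow> 'h::real_inner measure) \<Rightarrow> real measure" where
  "overlap_law P G = distr (P \<bind> (\<lambda>w. G w \<Otimes>\<^sub>M G w)) borel (\<lambda>(x, y). x \<bullet> y)"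

text \<open>
  The \<open>n(n-1)/2\<close> index pairs of \<open>R\<^sup>n\<close>; the space of real arrays over them plays the role of
  \<open>\<real>\<^sup>n\<^sup>(\<^sup>n\<^sup>-\<^sup>1\<^sup>)\<^sup>/\<^sup>2\<close>.
\<close>

definition pairs :: "nat \<Rightarrow> (nat \<times> nat) set" where
  "pairs n = {(l, l'). 1 \<le> l \<and> l < l' \<and> l' \<le> n}"

text \<open>
  In the following, \<open>f l\<close> is the function \<open>f\<^sub>l\<close>, \<open>x\<close> the distinguished point \<open>\<sigma>\<close>, and \<open>s l\<close> the
  replica \<open>\<sigma>\<^sup>l\<close>.
\<close>

definition F_sum ::
  "nat \<Rightarrow> (nat \<Rightarrow> (nat \<times> nat \<Rightarrow> real) \<times> real \<Rightarrow> real) \<Rightarrow> 'h::real_inner \<Rightarrow> (nat \<Rightarrow> 'h) \<Rightarrow> real" where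
  "F_sum n f x s = (\<Sum>l = 1..n. f l (overlap_array (pairs n) s, x \<bullet> s l))"

definition F_repl ::
  "real measure \<Rightarrow> nat \<Rightarrow> (nat \<Rightarrow> (nat \<times> nat \<Rightarrow> real) \<times> real \<Rightarrow> real) \<Rightarrow> nat \<Rightarrow>
    'h::real_inner \<Rightarrow> (nat \<Rightarrow> 'h) \<Rightarrow> real" where
  "F_repl \<mu> n f l x s =
    F_sum n f x s - f l (overlap_array (pairs n) s, x \<bullet> s l)
      + (\<integral>y. f l (overlap_array (pairs n) s, y) \<partial>\<mu>)"

definition F_bar ::
  "real measure \<Rightarrow> nat \<Rightarrow> (nat \<Rightarrow> (nat \<times> nat \<Rightarrow> real) \<times> real \<Rightarrow> real) \<Rightarrow>
    'h::real_inner \<Rightarrow> (nat \<Rightarrow> 'h) \<Rightarrow> real" where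
  "F_bar \<mu> n f x s = F_sum n f x s - 1 / real n * (\<Sum>l = 1..n. F_repl \<mu> n f l (s l) s)"

end

theory Submission
  imports Defs
begin

text \<open>
  Fix \<open>\<sigma>\<^sup>1, \<dots>, \<sigma>\<^sup>n\<close> and write \<open>F \<sigma>\<close> for the function \<open>F_bar\<close> at these replicas. It suffices to show
  that, almost surely, \<open>F \<ge> 0\<close> \<open>G\<close>-almost everywhere implies \<open>F = 0\<close> \<open>G\<close>-almost everywhere
  (\<open>F_nonneg_imp_F_eq_0\<close>): applied to the functions \<open>f\<^sub>l\<close> and to \<open>- f\<^sub>l\<close>, this gives all the claims.

  First, the Ghirlanda-Guerra identities extend from products \<open>f(R) \<psi>(R\<^sub>1\<^sub>,\<^sub>N\<^sub>+\<^sub>1)\<close> to all bounded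
  measurable functions of the pair \<open>(R, R\<^sub>1\<^sub>,\<^sub>N\<^sub>+\<^sub>1)\<close>, because both sides are integrals with respect to
  probability measures that agree on rectangles (\<open>ghirlanda_guerra_joint\<close>), and from replica 1 to any
  replica \<open>l \<le> N\<close> by exchangeability (\<open>ghirlanda_guerra_replica\<close>). Taking the test function
  \<open>g(R) f\<^sub>l(R\<^sup>n, R\<^sub>l\<^sub>,\<^sub>N\<^sub>+\<^sub>1)\<close> and summing over \<open>l \<le> n\<close>, the terms that only involve the first \<open>n\<close> replicas
  are exactly the ones subtracted in the definition of \<open>F_bar\<close>, and one obtains for \<open>N \<ge> n\<close>
  (\<open>ghirlanda_guerra_F\<close>)
    \<open>\<bbbE>\<langle>g(R) (N F(\<sigma>\<^sup>N\<^sup>+\<^sup>1) - F(\<sigma>\<^sup>n\<^sup>+\<^sup>1) - \<dots> - F(\<sigma>\<^sup>N))\<rangle> = 0\<close>.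

  Now let \<open>N = n + m\<close> and let \<open>g\<close> be the indicator that \<open>F(\<sigma>\<^sup>k) \<ge> 0\<close> for all \<open>n < k \<le> N\<close>; this is a
  function of the overlaps. Given \<open>\<sigma>\<^sup>1, \<dots>, \<sigma>\<^sup>n\<close>, the other replicas are independent, so with
  \<open>p = G(F \<ge> 0)\<close>, \<open>e = \<integral> F dG\<close> and \<open>a = \<integral> 1(F \<ge> 0) F dG\<close> the identity becomes
    \<open>\<bbbE>\<langle>(n + m) p\<^sup>m e - m p\<^sup>m\<^sup>-\<^sup>1 a\<rangle> = 0\<close>.
  The integrand equals \<open>n p\<^sup>m e + m p\<^sup>m (e - a) - m p\<^sup>m\<^sup>-\<^sup>1 (1 - p) a\<close>. It is bounded uniformly in \<open>m\<close>, since
  \<open>\<bar>e - a\<bar> \<le> C (1 - p)\<close> and \<open>m p\<^sup>m\<^sup>-\<^sup>1 (1 - p) \<le> 1\<close>, and as \<open>m \<rightarrow> \<infinity>\<close> it tends to \<open>0\<close> where \<open>p < 1\<close> and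
  to \<open>n e\<close> where \<open>p = 1\<close>. By dominated convergence \<open>\<bbbE>\<langle>1(p = 1) n e\<rangle> = 0\<close>. Where \<open>p = 1\<close>, \<open>e\<close> is the
  integral of an almost everywhere nonnegative function, so \<open>e = 0\<close> there almost surely, which means
  \<open>F = 0\<close> almost everywhere.
\<close>

section \<open>Bounded measurable functions\<close>

lemma bounded_measurableI:
  assumes "f \<in> borel_measurable M" "\<And>x. x \<in> space M \<Longrightarrow> \<bar>f x\<bar> \<le> C"
  shows "bounded_measurable M f"
  using assms by (auto simp: bounded_measurable_def bounded_iff)

lemma bounded_measurable_measurable [measurable_dest]:
  "bounded_measurable M f \<Longrightarrow> f \<in> borel_measurable M"
  by (simp add: bounded_measurable_def)

lemma bounded_measurable_bound:
  assumes "bounded_measurable M f"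
  obtains C where "C \<ge> 0" "\<And>x. x \<in> space M \<Longrightarrow> \<bar>f x\<bar> \<le> C"
proof -
  obtain C where C: "\<forall>x\<in>f ` space M. norm x \<le> C"
    using assms by (auto simp: bounded_measurable_def bounded_iff)
  show thesis
    by (rule that[of "\<bar>C\<bar>"]) (use C in force)+
qed

lemma bounded_measurable_compose:
  assumes "bounded_measurable N f" "g \<in> M \<rightarrow>\<^sub>M N"
  shows "bounded_measurable M (\<lambda>x. f (g x))"
proof -
  obtain C where C: "\<And>x. x \<in> space N \<Longrightarrow> \<bar>f x\<bar> \<le> C"
    using bounded_measurable_bound[OF assms(1)] by metis
  show ?thesis
    using assms C measurable_space[OF assms(2)]
    by (intro bounded_measurableI[of _ _ C] measurable_compose[OF assms(2)]) auto
qed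

lemma bounded_measurable_const: "bounded_measurable M (\<lambda>x. c)"
  by (intro bounded_measurableI[of _ _ "\<bar>c\<bar>"]) auto

lemma bounded_measurable_add:
  assumes "bounded_measurable M f" "bounded_measurable M g"
  shows "bounded_measurable M (\<lambda>x. f x + g x)"
proof -
  obtain C D where C: "\<And>x. x \<in> space M \<Longrightarrow> \<bar>f x\<bar> \<le> C" "\<And>x. x \<in> space M \<Longrightarrow> \<bar>g x\<bar> \<le> D"
    using bounded_measurable_bound[OF assms(1)] bounded_measurable_bound[OF assms(2)] by metis
  have "\<bar>f x + g x\<bar> \<le> C + D" if "x \<in> space M" for x
    using C(1)[OF that] C(2)[OF that] by linarith
  with assms show ?thesis
    by (intro bounded_measurableI[of _ _ "C + D"]) (auto dest: bounded_measurable_measurable)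
qed

lemma bounded_measurable_mult:
  assumes "bounded_measurable M f" "bounded_measurable M g"
  shows "bounded_measurable M (\<lambda>x. f x * g x)"
proof -
  obtain C D where C: "\<And>x. x \<in> space M \<Longrightarrow> \<bar>f x\<bar> \<le> C" "\<And>x. x \<in> space M \<Longrightarrow> \<bar>g x\<bar> \<le> D"
    using bounded_measurable_bound[OF assms(1)] bounded_measurable_bound[OF assms(2)] by metis
  have "\<bar>f x * g x\<bar> \<le> C * D" if "x \<in> space M" for x
    unfolding abs_mult using C(1)[OF that] C(2)[OF that] by (intro mult_mono) auto
  with assms show ?thesis
    by (intro bounded_measurableI[of _ _ "C * D"]) (auto dest: bounded_measurable_measurable)
qed

lemma bounded_measurable_minus:
  "bounded_measurable M f \<Longrightarrow> bounded_measurable M (\<lambda>x. - f x)"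
  using bounded_measurable_mult[OF bounded_measurable_const[of M "-1"], of f] by simp

lemma bounded_measurable_diff:
  "bounded_measurable M f \<Longrightarrow> bounded_measurable M g \<Longrightarrow> bounded_measurable M (\<lambda>x. f x - g x)"
  using bounded_measurable_add[OF _ bounded_measurable_minus, of M f g] by simp

lemma bounded_measurable_sum:
  "(\<And>i. i \<in> I \<Longrightarrow> bounded_measurable M (f i)) \<Longrightarrow> bounded_measurable M (\<lambda>x. \<Sum>i\<in>I. f i x)"
  by (induction I rule: infinite_finite_induct)
     (auto intro: bounded_measurable_const bounded_measurable_add)

lemma bounded_measurable_prod:
  "(\<And>i. i \<in> I \<Longrightarrow> bounded_measurable M (f i)) \<Longrightarrow> bounded_measurable M (\<lambda>x. \<Prod>i\<in>I. f i x)"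
  by (induction I rule: infinite_finite_induct)
     (auto intro: bounded_measurable_const bounded_measurable_mult)

lemma bounded_measurable_indicator:
  "X \<in> sets M \<Longrightarrow> bounded_measurable M (indicator X :: _ \<Rightarrow> real)"
  by (intro bounded_measurableI[of _ _ 1]) auto

lemma bounded_measurable_of_bool:
  "Measurable.pred M A \<Longrightarrow> bounded_measurable M (\<lambda>x. of_bool (A x))"
  by (intro bounded_measurableI[of _ _ 1]) auto

lemma bounded_measurable_integrable:
  assumes "bounded_measurable M f" "prob_space M"
  shows "integrable M f"
proof -
  interpret prob_space M by fact
  obtain C where "\<And>x. x \<in> space M \<Longrightarrow> \<bar>f x\<bar> \<le> C"
    using bounded_measurable_bound[OF assms(1)] by metis
  with assms(1) show ?thesis
    by (intro integrable_const_bound[of _ C]) (auto dest: bounded_measurable_measurable)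
qed

lemma bounded_measurable_cong_sets:
  "sets M = sets N \<Longrightarrow> bounded_measurable M f \<longleftrightarrow> bounded_measurable N f"
  unfolding bounded_measurable_def
  using measurable_cong_sets[of M N borel "borel :: real measure"] sets_eq_imp_space_eq[of M N] by simp

lemma bounded_measurable_lebesgue_integral:
  assumes f: "bounded_measurable (M \<Otimes>\<^sub>M N) f" and N: "prob_space N"
  shows "bounded_measurable M (\<lambda>x. \<integral>y. f (x, y) \<partial>N)"
proof -
  interpret N: prob_space N by fact
  obtain C where C: "\<And>x. x \<in> space (M \<Otimes>\<^sub>M N) \<Longrightarrow> \<bar>f x\<bar> \<le> C"
    using bounded_measurable_bound[OF f] by metis
  note [measurable] = f
  have "\<bar>\<integral>y. f (x, y) \<partial>N\<bar> \<le> C" if "x \<in> space M" for x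
  proof -
    have "integrable N (\<lambda>y. f (x, y))"
      using that C measurable_compose[OF measurable_Pair1'[OF that] bounded_measurable_measurable[OF f]]
      by (intro N.integrable_const_bound[of _ C]) (auto simp: space_pair_measure)
    moreover from this have "integrable N (\<lambda>y. \<bar>f (x, y)\<bar>)"
      by simp
    then have "(\<integral>y. \<bar>f (x, y)\<bar> \<partial>N) \<le> (\<integral>y. C \<partial>N)"
      using that C by (intro integral_mono) (auto simp: space_pair_measure)
    ultimately show ?thesis
      by (intro order_trans[OF integral_abs_bound]) (simp add: N.prob_space)
  qed
  then show ?thesis
    using N.borel_measurable_lebesgue_integral[of "\<lambda>x y. f (x, y)" M] f
    by (intro bounded_measurableI[of _ _ C]) (auto dest: bounded_measurable_measurable)
qed

lemma bounded_measurable_of_bool_nonneg: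
  "bounded_measurable M f \<Longrightarrow> bounded_measurable M (\<lambda>x. of_bool (f x \<ge> 0))"
  by (intro bounded_measurable_of_bool) (auto dest: bounded_measurable_measurable)

lemma bounded_measurable_power:
  "bounded_measurable M f \<Longrightarrow> bounded_measurable M (\<lambda>x. f x ^ k)"
  by (induction k) (auto intro: bounded_measurable_const bounded_measurable_mult)

lemma bounded_measurable_lebesgue_integral_fst:
  assumes "bounded_measurable (N \<Otimes>\<^sub>M M) f" "prob_space N"
  shows "bounded_measurable M (\<lambda>x. \<integral>y. f (y, x) \<partial>N)"
  using bounded_measurable_lebesgue_integral[OF bounded_measurable_compose[OF assms(1)
      measurable_pair_swap'] assms(2)] by simp

section \<open>Moments of a number in the unit interval\<close>

lemma geometric_moment_le_1:
  fixes p :: real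
  assumes p: "0 \<le> p" "p \<le> 1"
  shows "real (Suc i) * p ^ i * (1 - p) \<le> 1"
proof -
  have "real (Suc i) * p ^ i = (\<Sum>k<Suc i. p ^ i)"
    by simp
  also have "\<dots> \<le> (\<Sum>k<Suc i. p ^ k)"
    using p by (intro sum_mono power_decreasing) auto
  finally have "real (Suc i) * p ^ i * (1 - p) \<le> (1 - p) * (\<Sum>k<Suc i. p ^ k)"
    using p by (simp add: mult.commute mult_left_mono)
  also have "\<dots> = 1 - p ^ Suc i"
    by (rule one_diff_power_eq[symmetric])
  also have "\<dots> \<le> 1"
    using p by simp
  finally show ?thesis .
qed

text \<open>
  With \<open>m = i + 1\<close>, the difference equals \<open>n p\<^sup>m e + m p\<^sup>m (e - a) - m p\<^sup>m\<^sup>-\<^sup>1 (1 - p) a\<close>, and the three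
  terms are at most \<open>n C\<close>, \<open>C\<close> and \<open>C\<close> in absolute value.
\<close>

lemma moment_difference_bound:
  fixes p a e C :: real
  assumes p: "0 \<le> p" "p \<le> 1" and a: "\<bar>a\<bar> \<le> C" and e: "\<bar>e\<bar> \<le> C" and ea: "\<bar>e - a\<bar> \<le> C * (1 - p)"
  shows "\<bar>real (n + Suc i) * p ^ Suc i * e - real (Suc i) * p ^ i * a\<bar> \<le> (real n + 2) * C"
proof -
  let ?m = "real (Suc i)"
  let ?g = "?m * p ^ i * (1 - p)"
  have C: "0 \<le> C" using a by linarith
  have pi: "0 \<le> p ^ i" "p ^ i \<le> 1" "0 \<le> p ^ Suc i" "p ^ Suc i \<le> 1"
    using p by (auto intro: power_le_one simp del: power_Suc)
  have g: "0 \<le> ?g" "?g \<le> 1"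
    using p pi geometric_moment_le_1[OF p, of i] by (auto simp del: of_nat_Suc)
  have "real (n + Suc i) * p ^ Suc i * e - ?m * p ^ i * a =
    real n * p ^ Suc i * e + p * (?m * p ^ i) * (e - a) - ?g * a"
    by (simp add: algebra_simps)
  also have "\<bar>\<dots>\<bar> \<le> \<bar>real n * p ^ Suc i * e\<bar> + \<bar>p * (?m * p ^ i) * (e - a)\<bar> + \<bar>?g * a\<bar>"
    by linarith
  also have "\<bar>real n * p ^ Suc i * e\<bar> \<le> real n * C"
  proof -
    have "\<bar>real n * p ^ Suc i * e\<bar> = real n * (p ^ Suc i * \<bar>e\<bar>)"
      using p by (simp add: abs_mult)
    also have "\<dots> \<le> real n * (1 * C)"
      using pi e by (intro mult_left_mono mult_mono) auto
    finally show ?thesis by simp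
  qed
  also have "\<bar>p * (?m * p ^ i) * (e - a)\<bar> \<le> C"
  proof -
    have "\<bar>p * (?m * p ^ i) * (e - a)\<bar> = p * (?m * p ^ i) * \<bar>e - a\<bar>"
      using p by (simp add: abs_mult)
    also have "\<dots> \<le> p * (?m * p ^ i) * (C * (1 - p))"
      using p by (intro mult_left_mono ea) auto
    also have "\<dots> = (p * ?g) * C"
      by (simp add: algebra_simps)
    also have "\<dots> \<le> (1 * 1) * C"
      using p g C by (intro mult_right_mono mult_mono) auto
    finally show ?thesis by simp
  qed
  also have "\<bar>?g * a\<bar> \<le> C"
    using mult_mono[OF g(2) a] unfolding abs_mult[of ?g a] abs_of_nonneg[OF g(1)] by simp
  finally show ?thesis
    by (simp add: algebra_simps)
qed

lemma moment_difference_tendsto: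
  fixes p a e C :: real
  assumes p: "0 \<le> p" "p \<le> 1" and ea: "\<bar>e - a\<bar> \<le> C * (1 - p)"
  shows "(\<lambda>i. real (n + Suc i) * p ^ Suc i * e - real (Suc i) * p ^ i * a)
    \<longlonglongrightarrow> (if p = 1 then real n * e else 0)"
proof (cases "p = 1")
  case True
  with ea have "a = e" by simp
  then show ?thesis
    using True by (simp add: algebra_simps)
next
  case False
  then have p1: "norm p < 1" using p by simp
  have 1: "(\<lambda>i. real i * p ^ i) \<longlonglongrightarrow> 0"
    using powser_times_n_limit_0[OF p1] by simp
  have 2: "(\<lambda>i. p ^ i) \<longlonglongrightarrow> 0"
    using p1 by (intro LIMSEQ_power_zero)
  have "(\<lambda>i. (real n * p ^ Suc i + real (Suc i) * p ^ Suc i) * e - (real i * p ^ i + p ^ i) * a) \<longlonglongrightarrow>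
    (real n * 0 + 0) * e - (0 + 0) * a"
    by (intro tendsto_intros LIMSEQ_Suc[OF 1] LIMSEQ_Suc[OF 2] 1 2)
  then show ?thesis
    using False by (simp add: algebra_simps)
qed

section \<open>The annealed law of the replicas\<close>

lemma measurable_PiM_prob_algebra:
  assumes K: "K \<in> M \<rightarrow>\<^sub>M prob_algebra N"
  shows "(\<lambda>w. \<Pi>\<^sub>M i\<in>I. K w) \<in> M \<rightarrow>\<^sub>M prob_algebra (\<Pi>\<^sub>M i\<in>I. N)"
proof (rule measurable_prob_algebra_generated[OF sets_PiM Int_stable_prod_algebra
      prod_algebra_sets_into_space])
  fix w assume w: "w \<in> space M"
  then have w': "prob_space (K w)" "sets (K w) = sets N"
    using measurable_space[OF K w] by (auto simp: space_prob_algebra)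
  then show "prob_space (\<Pi>\<^sub>M i\<in>I. K w)"
    by (intro prob_space_PiM)
  show "sets (\<Pi>\<^sub>M i\<in>I. K w) = sets (\<Pi>\<^sub>M i\<in>I. N)"
    using w' by (intro sets_PiM_cong) auto
next
  fix A assume "A \<in> prod_algebra I (\<lambda>i. N)"
  then obtain J E where A: "A = prod_emb I (\<lambda>i. N) J (\<Pi>\<^sub>E j\<in>J. E j)"
    and J: "finite J" "J \<subseteq> I" "\<And>i. i \<in> J \<Longrightarrow> E i \<in> sets N"
    by (auto elim!: prod_algebraE)
  have "emeasure (\<Pi>\<^sub>M i\<in>I. K w) A = (\<Prod>j\<in>J. emeasure (K w) (E j))" if w: "w \<in> space M" for w
  proof -
    have w': "prob_space (K w)" "sets (K w) = sets N"
      using measurable_space[OF K w] by (auto simp: space_prob_algebra)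
    then have "A = prod_emb I (\<lambda>i. K w) J (\<Pi>\<^sub>E j\<in>J. E j)"
      using sets_eq_imp_space_eq[OF w'(2)] by (simp add: A prod_emb_def)
    with w' J show ?thesis
      by (simp add: emeasure_PiM_emb)
  qed
  moreover have "(\<lambda>w. \<Prod>j\<in>J. emeasure (K w) (E j)) \<in> borel_measurable M"
    using measurable_prob_algebraD[OF K] J
    by (intro borel_measurable_prod_ennreal measurable_emeasure_kernel) auto
  ultimately show "(\<lambda>w. emeasure (\<Pi>\<^sub>M i\<in>I. K w) A) \<in> borel_measurable M"
    by (simp cong: measurable_cong)
qed

lemma distr_PiM_two_components:
  assumes "prob_space M" "i \<in> I" "j \<in> I" "i \<noteq> j"
  shows "distr (\<Pi>\<^sub>M i\<in>I. M) (M \<Otimes>\<^sub>M M) (\<lambda>s. (s i, s j)) = M \<Otimes>\<^sub>M M"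
proof -
  interpret M: prob_space M by fact
  interpret product_prob_space "\<lambda>_. M" I ..
  have [measurable]: "(\<lambda>s. s i) \<in> (\<Pi>\<^sub>M i\<in>I. M) \<rightarrow>\<^sub>M M" "(\<lambda>s. s j) \<in> (\<Pi>\<^sub>M i\<in>I. M) \<rightarrow>\<^sub>M M"
    using assms by auto
  show ?thesis
  proof (rule pair_measure_eqI[symmetric])
    fix A B assume [measurable]: "A \<in> sets M" "B \<in> sets M"
    have "emeasure (distr (\<Pi>\<^sub>M i\<in>I. M) (M \<Otimes>\<^sub>M M) (\<lambda>s. (s i, s j))) (A \<times> B) =
      emeasure (\<Pi>\<^sub>M i\<in>I. M) {s \<in> space (\<Pi>\<^sub>M i\<in>I. M). \<forall>k\<in>{i, j}. s k \<in> (if k = i then A else B)}"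
      using assms(4) by (subst emeasure_distr) (auto intro!: arg_cong2[where f=emeasure])
    also have "\<dots> = emeasure M A * emeasure M B"
      using assms by (subst emeasure_PiM_Collect) auto
    finally show "emeasure M A * emeasure M B =
      emeasure (distr (\<Pi>\<^sub>M i\<in>I. M) (M \<Otimes>\<^sub>M M) (\<lambda>s. (s i, s j))) (A \<times> B)" by simp
  qed (auto intro: M.sigma_finite_measure_axioms)
qed

text \<open>
  Conditionally on the coordinates in \<open>I\<close>, the other coordinates of a product measure are independent
  with law \<open>M\<close>.
\<close>

lemma integral_PiM_conditional_prod:
  fixes q :: "'i \<Rightarrow> 'a \<times> ('i \<Rightarrow> 'a) \<Rightarrow> real"
  assumes M: "prob_space M" and IJ: "finite I" "finite J" "I \<inter> J = {}" "I \<union> J \<subseteq> K"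
    and q: "\<And>k. k \<in> J \<Longrightarrow> bounded_measurable (M \<Otimes>\<^sub>M (\<Pi>\<^sub>M i\<in>I. M)) (q k)"
  shows "(\<integral>s. (\<Prod>k\<in>J. q k (s k, restrict s I)) \<partial>(\<Pi>\<^sub>M i\<in>K. M)) =
    (\<integral>s. (\<Prod>k\<in>J. \<integral>x. q k (x, s) \<partial>M) \<partial>(\<Pi>\<^sub>M i\<in>I. M))"
proof -
  interpret prob_space M by fact
  interpret product_prob_space "\<lambda>_. M" K ..
  interpret IJ: prob_space "\<Pi>\<^sub>M i\<in>I \<union> J. M"
    by (rule prob_space_PiM[OF M])
  let ?\<phi> = "\<lambda>s. \<Prod>k\<in>J. q k (s k, restrict s I)"
  have \<phi>: "bounded_measurable (\<Pi>\<^sub>M i\<in>I \<union> J. M) ?\<phi>"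
    by (intro bounded_measurable_prod bounded_measurable_compose[OF q] measurable_Pair
        measurable_component_singleton measurable_restrict_subset) auto
  have "(\<integral>s. ?\<phi> s \<partial>(\<Pi>\<^sub>M i\<in>K. M)) = (\<integral>s. ?\<phi> (restrict s (I \<union> J)) \<partial>(\<Pi>\<^sub>M i\<in>K. M))"
    by (intro Bochner_Integration.integral_cong prod.cong refl)
       (auto simp: Int_absorb1 intro!: arg_cong2[where f=q])
  also have "\<dots> = (\<integral>s. ?\<phi> s \<partial>distr (\<Pi>\<^sub>M i\<in>K. M) (\<Pi>\<^sub>M i\<in>I \<union> J. M) (\<lambda>s. restrict s (I \<union> J)))"
    using \<phi> IJ by (intro integral_distr[symmetric] measurable_restrict_subset bounded_measurable_measurable)
  also have "\<dots> = (\<integral>s. ?\<phi> s \<partial>(\<Pi>\<^sub>M i\<in>I \<union> J. M))"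
    using IJ by (subst distr_PiM_restrict_finite) auto
  also have "\<dots> = (\<integral>s. (\<integral>t. ?\<phi> (merge I J (s, t)) \<partial>(\<Pi>\<^sub>M i\<in>J. M)) \<partial>(\<Pi>\<^sub>M i\<in>I. M))"
    using IJ bounded_measurable_integrable[OF \<phi> IJ.prob_space_axioms] by (intro product_integral_fold)
  also have "\<dots> = (\<integral>s. (\<Prod>k\<in>J. \<integral>x. q k (x, s) \<partial>M) \<partial>(\<Pi>\<^sub>M i\<in>I. M))"
  proof (rule Bochner_Integration.integral_cong[OF refl])
    fix s assume s: "s \<in> space (\<Pi>\<^sub>M i\<in>I. M)"
    have "restrict (merge I J (s, t)) I = s" for t
      using s by (auto simp: space_PiM PiE_def extensional_def fun_eq_iff restrict_def merge_def)
    moreover have "merge I J (s, t) k = t k" if "k \<in> J" for t k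
      using that IJ(3) by auto
    ultimately have "(\<integral>t. ?\<phi> (merge I J (s, t)) \<partial>(\<Pi>\<^sub>M i\<in>J. M)) =
      (\<integral>t. (\<Prod>k\<in>J. q k (t k, s)) \<partial>(\<Pi>\<^sub>M i\<in>J. M))"
      by simp
    also have "\<dots> = (\<Prod>k\<in>J. \<integral>x. q k (x, s) \<partial>M)"
      using IJ(2) s
      by (intro product_integral_prod bounded_measurable_integrable[OF _ M]
          bounded_measurable_compose[OF q] measurable_Pair2') auto
    finally show "(\<integral>t. ?\<phi> (merge I J (s, t)) \<partial>(\<Pi>\<^sub>M i\<in>J. M)) = \<dots>" .
  qed
  finally show ?thesis .
qed

text \<open>
  A random probability measure on the unit ball of a separable Hilbert space.
\<close>

locale random_measure =
  fixes P :: "'w measure"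
    and G :: "'w \<Rightarrow> 'h::{real_inner, complete_space, second_countable_topology} measure"
  assumes random_prob_measure: "random_prob_measure P G"
begin

sublocale prob_space P
  using random_prob_measure by (simp add: random_prob_measure_def)

lemma G_measurable: "G \<in> P \<rightarrow>\<^sub>M prob_algebra unit_ball_borel"
  using random_prob_measure by (simp add: random_prob_measure_def)

lemma prob_space_G: "w \<in> space P \<Longrightarrow> prob_space (G w)"
  and sets_G: "w \<in> space P \<Longrightarrow> sets (G w) = sets unit_ball_borel"
  using measurable_space[OF G_measurable] by (auto simp: space_prob_algebra)

abbreviation configurations :: "(nat \<Rightarrow> 'h) measure" where
  "configurations \<equiv> \<Pi>\<^sub>M i\<in>{1..}. unit_ball_borel"

text \<open>
  The law \<open>\<bbbE>G\<^sup>\<otimes>\<^sup>\<infinity>\<close> of the replicas: \<open>annealed P G \<phi>\<close> is the integral of \<open>\<phi>\<close> with respect to it.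
\<close>

definition annealed_law :: "(nat \<Rightarrow> 'h) measure" where
  "annealed_law = P \<bind> (\<lambda>w. \<Pi>\<^sub>M i\<in>{1..}. G w)"

lemma P_in_space: "P \<in> space (prob_algebra P)"
  by (simp add: space_prob_algebra prob_space_axioms)

lemma replicas_measurable: "(\<lambda>w. \<Pi>\<^sub>M i\<in>I. G w) \<in> P \<rightarrow>\<^sub>M prob_algebra (\<Pi>\<^sub>M i\<in>I. unit_ball_borel)"
  by (rule measurable_PiM_prob_algebra[OF G_measurable])

lemma sets_annealed_law [measurable_cong]: "sets annealed_law = sets configurations"
  unfolding annealed_law_def by (rule sets_bind'[OF P_in_space replicas_measurable])

lemma prob_space_annealed_law: "prob_space annealed_law"
  unfolding annealed_law_def by (rule prob_space_bind'[OF P_in_space replicas_measurable])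

lemma integral_bind_kernel:
  fixes \<phi> :: "'b \<Rightarrow> real"
  assumes K: "K \<in> P \<rightarrow>\<^sub>M prob_algebra N" and "bounded_measurable N \<phi>"
  shows "(\<integral>x. \<phi> x \<partial>(P \<bind> K)) = (\<integral>w. (\<integral>x. \<phi> x \<partial>K w) \<partial>P)"
proof -
  obtain C where "\<And>x. x \<in> space N \<Longrightarrow> \<bar>\<phi> x\<bar> \<le> C"
    using bounded_measurable_bound[OF assms(2)] by metis
  then show ?thesis
    using assms measurable_space[OF K]
    by (intro integral_bind[where K=N and B=C and B'=1] measurable_prob_algebraD)
       (auto simp: finite_measure_axioms space_prob_algebra prob_space.emeasure_space_1
         dest: bounded_measurable_measurable)
qed

lemma annealed_eq:
  assumes "bounded_measurable configurations \<phi>"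
  shows "annealed P G \<phi> = (\<integral>s. \<phi> s \<partial>annealed_law)"
  unfolding annealed_def annealed_law_def
  by (rule integral_bind_kernel[OF replicas_measurable assms, symmetric])

lemma overlap_measurable [measurable]:
  assumes "i \<in> I" "j \<in> I"
  shows "(\<lambda>s. overlap s i j) \<in> borel_measurable (\<Pi>\<^sub>M i\<in>I. (unit_ball_borel :: 'h measure))"
proof -
  have *: "(\<lambda>s. s k) \<in> borel_measurable (\<Pi>\<^sub>M i\<in>I. (unit_ball_borel :: 'h measure))" if "k \<in> I" for k
  proof -
    have "(\<lambda>s. s k) \<in> (\<Pi>\<^sub>M i\<in>I. (unit_ball_borel :: 'h measure)) \<rightarrow>\<^sub>M unit_ball_borel"
      using that by simp
    moreover have "(\<lambda>x. x) \<in> borel_measurable (unit_ball_borel :: 'h measure)"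
      unfolding unit_ball_borel_def by (intro measurable_restrict_space1) auto
    ultimately show ?thesis
      by (rule measurable_compose)
  qed
  show ?thesis
    unfolding overlap_def using *[OF assms(1)] *[OF assms(2)] by measurable
qed

lemma overlap_array_measurable:
  assumes "J \<subseteq> I \<times> I"
  shows "overlap_array J \<in> (\<Pi>\<^sub>M i\<in>I. (unit_ball_borel :: 'h measure)) \<rightarrow>\<^sub>M real_arrays J"
  unfolding overlap_array_def using assms
  by (intro measurable_restrict) (auto intro: overlap_measurable)

lemma inner_measurable:
  "(\<lambda>(x, y). x \<bullet> y) \<in> borel_measurable (unit_ball_borel \<Otimes>\<^sub>M (unit_ball_borel :: 'h measure))"
proof -
  have [measurable]: "(\<lambda>x. x) \<in> borel_measurable (unit_ball_borel :: 'h measure)"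
    unfolding unit_ball_borel_def by (intro measurable_restrict_space1) auto
  show ?thesis by measurable
qed

lemma sets_overlap_law [measurable_cong, simp]: "sets (overlap_law P G) = sets borel"
  by (simp add: overlap_law_def)

lemma prob_space_overlap_law: "prob_space (overlap_law P G)"
proof -
  have G2: "(\<lambda>w. G w \<Otimes>\<^sub>M G w) \<in> P \<rightarrow>\<^sub>M prob_algebra (unit_ball_borel \<Otimes>\<^sub>M unit_ball_borel)"
    using G_measurable by measurable
  show ?thesis
    unfolding overlap_law_def using inner_measurable
    by (intro prob_space.prob_space_distr prob_space_bind'[OF P_in_space G2])
       (simp add: measurable_cong_sets[OF sets_bind'[OF P_in_space G2] refl])
qed

lemma integral_overlap_law:
  assumes \<psi>: "bounded_measurable borel \<psi>"
  shows "(\<integral>y. \<psi> y \<partial>overlap_law P G) = (\<integral>s. \<psi> (overlap s 1 2) \<partial>annealed_law)"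
proof -
  have G2: "(\<lambda>w. G w \<Otimes>\<^sub>M G w) \<in> P \<rightarrow>\<^sub>M prob_algebra (unit_ball_borel \<Otimes>\<^sub>M unit_ball_borel)"
    using G_measurable by measurable
  note \<psi>2 = bounded_measurable_compose[OF \<psi> inner_measurable]
  have "(\<integral>y. \<psi> y \<partial>overlap_law P G) = (\<integral>z. \<psi> (case z of (x, y) \<Rightarrow> x \<bullet> y) \<partial>(P \<bind> (\<lambda>w. G w \<Otimes>\<^sub>M G w)))"
    unfolding overlap_law_def using inner_measurable \<psi>
    by (intro integral_distr)
       (simp_all add: measurable_cong_sets[OF sets_bind'[OF P_in_space G2] refl] bounded_measurable_def)
  also have "\<dots> = (\<integral>w. (\<integral>z. \<psi> (case z of (x, y) \<Rightarrow> x \<bullet> y) \<partial>(G w \<Otimes>\<^sub>M G w)) \<partial>P)"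
    by (rule integral_bind_kernel[OF G2 \<psi>2])
  also have "\<dots> = annealed P G (\<lambda>s. \<psi> (overlap s 1 2))"
    unfolding annealed_def
  proof (intro Bochner_Integration.integral_cong refl)
    fix w assume w: "w \<in> space P"
    have s: "sets (G w \<Otimes>\<^sub>M G w) = sets (unit_ball_borel \<Otimes>\<^sub>M unit_ball_borel)"
      by (intro sets_pair_measure_cong sets_G w)
    have "(\<integral>z. \<psi> (case z of (x, y) \<Rightarrow> x \<bullet> y) \<partial>(G w \<Otimes>\<^sub>M G w)) =
      (\<integral>z. \<psi> (case z of (x, y) \<Rightarrow> x \<bullet> y)
        \<partial>distr (\<Pi>\<^sub>M i\<in>{1..}. G w) (G w \<Otimes>\<^sub>M G w) (\<lambda>s. (s (1::nat), s 2)))"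
      by (subst distr_PiM_two_components[OF prob_space_G[OF w]]) auto
    also have "\<dots> = (\<integral>s. \<psi> (overlap s 1 2) \<partial>(\<Pi>\<^sub>M i\<in>{1..}. G w))"
      unfolding overlap_def using \<psi>2 s
      by (subst integral_distr) (auto simp: measurable_cong_sets[OF s refl] bounded_measurable_def)
    finally show "(\<integral>z. \<psi> (case z of (x, y) \<Rightarrow> x \<bullet> y) \<partial>(G w \<Otimes>\<^sub>M G w)) = \<dots>" .
  qed
  also have "\<dots> = (\<integral>s. \<psi> (overlap s 1 2) \<partial>annealed_law)"
    by (intro annealed_eq bounded_measurable_compose[OF \<psi>] overlap_measurable) auto
  finally show ?thesis .
qed

section \<open>The Ghirlanda-Guerra identities for joint test functions\<close>

text \<open>
  Both sides, divided by \<open>N\<close>, are integrals of \<open>h\<close> with respect to probability measures: the left one is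
  the law of the overlaps of \<open>N\<close> replicas and of \<open>R\<^sub>1\<^sub>,\<^sub>N\<^sub>+\<^sub>1\<close>, the right one the mixture, over a uniform
  \<open>j \<in> {1..N}\<close>, of the laws obtained by replacing \<open>R\<^sub>1\<^sub>,\<^sub>N\<^sub>+\<^sub>1\<close> with \<open>R\<^sub>1\<^sub>,\<^sub>j\<close> (\<open>j \<ge> 2\<close>) or with an independent
  sample from \<open>\<mu>\<close> (\<open>j = 1\<close>). By hypothesis they agree on rectangles.
\<close>

lemma ghirlanda_guerra_joint:
  fixes N h
  defines "R \<equiv> overlap_array ({1..N} \<times> {1..N}) :: (nat \<Rightarrow> 'h) \<Rightarrow> _"
  assumes gg: "ghirlanda_guerra P G" and N: "N \<ge> 2"
    and h: "bounded_measurable (real_arrays ({1..N} \<times> {1..N}) \<Otimes>\<^sub>M borel) h"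
  shows "real N * (\<integral>s. h (R s, overlap s 1 (N + 1)) \<partial>annealed_law) =
    (\<integral>s. (\<integral>y. h (R s, y) \<partial>overlap_law P G) \<partial>annealed_law)
    + (\<Sum>j = 2..N. \<integral>s. h (R s, overlap s 1 j) \<partial>annealed_law)"
proof -
  let ?A = "real_arrays ({1..N} \<times> {1..N})" and ?\<mu> = "overlap_law P G"
  interpret Q: prob_space annealed_law by (rule prob_space_annealed_law)
  interpret \<mu>: prob_space ?\<mu> by (rule prob_space_overlap_law)
  have R: "R \<in> configurations \<rightarrow>\<^sub>M ?A"
    unfolding R_def by (intro overlap_array_measurable) auto
  then have RQ [measurable]: "R \<in> annealed_law \<rightarrow>\<^sub>M ?A"
    by (simp add: measurable_cong_sets[OF sets_annealed_law refl])
  have ov: "(\<lambda>s. overlap s 1 j) \<in> borel_measurable configurations" if "j \<ge> 1" for j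
    using that by (intro overlap_measurable) auto
  have ovQ [measurable]: "(\<lambda>s. overlap s 1 j) \<in> borel_measurable annealed_law" if "j \<ge> 1" for j
    using ov[OF that] by (simp add: measurable_cong_sets[OF sets_annealed_law refl])
  have pair: "(\<lambda>s. (R s, overlap s 1 j)) \<in> annealed_law \<rightarrow>\<^sub>M ?A \<Otimes>\<^sub>M borel" if "j \<ge> 1" for j
    using that by measurable
  define D where "D = distr annealed_law ?A R"
  interpret D: prob_space D
    unfolding D_def by (rule Q.prob_space_distr) (rule RQ)
  interpret D\<mu>: pair_prob_space D ?\<mu> ..
  have sets_D\<mu>: "sets (D \<Otimes>\<^sub>M ?\<mu>) = sets (?A \<Otimes>\<^sub>M borel)"
    by (intro sets_pair_measure_cong) (auto simp: D_def)
  \<comment> \<open>The product measure is the component for \<open>j = 1\<close>; indices outside \<open>{1..N}\<close> have weight zero.\<close>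
  define \<kappa> where "\<kappa> j = (if j \<in> {2..N} then distr annealed_law (?A \<Otimes>\<^sub>M borel) (\<lambda>s. (R s, overlap s 1 j))
    else D \<Otimes>\<^sub>M ?\<mu>)" for j
  define L1 where "L1 = distr annealed_law (?A \<Otimes>\<^sub>M borel) (\<lambda>s. (R s, overlap s 1 (N + 1)))"
  define p where "p = measure_pmf (pmf_of_set {1..N})"
  interpret p: prob_space p
    unfolding p_def by (rule measure_pmf.prob_space_axioms)
  define L2 where "L2 = p \<bind> \<kappa>"
  have "\<kappa> j \<in> space (prob_algebra (?A \<Otimes>\<^sub>M borel))" for j
  proof (cases "j \<in> {2..N}")
    case True
    then have "prob_space (distr annealed_law (?A \<Otimes>\<^sub>M borel) (\<lambda>s. (R s, overlap s 1 j)))"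
      by (intro Q.prob_space_distr pair) auto
    with True show ?thesis
      by (simp add: \<kappa>_def space_prob_algebra)
  next
    case False
    then have "\<kappa> j = D \<Otimes>\<^sub>M ?\<mu>"
      by (auto simp: \<kappa>_def)
    then show ?thesis
      using sets_D\<mu> by (simp add: space_prob_algebra D\<mu>.prob_space_axioms)
  qed
  then have \<kappa>: "\<kappa> \<in> p \<rightarrow>\<^sub>M prob_algebra (?A \<Otimes>\<^sub>M borel)"
    unfolding p_def by (simp add: measurable_cong_sets[OF sets_measure_pmf_count_space refl])
  have p_space: "p \<in> space (prob_algebra p)"
    by (simp add: space_prob_algebra p.prob_space_axioms)
  have sets_L2: "sets L2 = sets (?A \<Otimes>\<^sub>M borel)"
    unfolding L2_def by (rule sets_bind'[OF p_space \<kappa>])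
  interpret L1: prob_space L1
    unfolding L1_def by (intro Q.prob_space_distr pair) auto
  interpret L2: prob_space L2
    unfolding L2_def by (rule prob_space_bind'[OF p_space \<kappa>])

  have int_L1: "(\<integral>z. g z \<partial>L1) = (\<integral>s. g (R s, overlap s 1 (N + 1)) \<partial>annealed_law)"
    if "bounded_measurable (?A \<Otimes>\<^sub>M borel) g" for g :: "_ \<Rightarrow> real"
    unfolding L1_def using that by (intro integral_distr pair bounded_measurable_measurable) auto
  have int_L2: "real N * (\<integral>z. g z \<partial>L2) = (\<integral>s. (\<integral>y. g (R s, y) \<partial>?\<mu>) \<partial>annealed_law)
    + (\<Sum>j = 2..N. \<integral>s. g (R s, overlap s 1 j) \<partial>annealed_law)"
    if g: "bounded_measurable (?A \<Otimes>\<^sub>M borel) g" for g :: "_ \<Rightarrow> real"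
  proof -
    obtain C where C: "\<And>x. x \<in> space (?A \<Otimes>\<^sub>M borel) \<Longrightarrow> \<bar>g x\<bar> \<le> C"
      using bounded_measurable_bound[OF g] by metis
    have g': "bounded_measurable (D \<Otimes>\<^sub>M ?\<mu>) g" "bounded_measurable (?A \<Otimes>\<^sub>M ?\<mu>) g"
      using g bounded_measurable_cong_sets[OF sets_D\<mu>]
        bounded_measurable_cong_sets[OF sets_pair_measure_cong[OF refl sets_overlap_law]] by blast+
    have "(\<integral>z. g z \<partial>L2) = (\<integral>j. (\<integral>z. g z \<partial>\<kappa> j) \<partial>p)"
      unfolding L2_def using C g measurable_space[OF \<kappa>]
      by (intro integral_bind[where K="?A \<Otimes>\<^sub>M borel" and B=C and B'=1] measurable_prob_algebraD[OF \<kappa>])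
         (auto simp: p.finite_measure_axioms space_prob_algebra prob_space.emeasure_space_1
           dest: bounded_measurable_measurable)
    then have "real N * (\<integral>z. g z \<partial>L2) = (\<Sum>j = 1..N. \<integral>z. g z \<partial>\<kappa> j)"
      using N unfolding p_def by (subst (asm) integral_pmf_of_set) auto
    also have "\<dots> = (\<integral>z. g z \<partial>\<kappa> 1) + (\<Sum>j = 2..N. \<integral>z. g z \<partial>\<kappa> j)"
      using N by (subst sum.atLeast_Suc_atMost) (auto simp: numeral_2_eq_2)
    also have "(\<integral>z. g z \<partial>\<kappa> 1) = (\<integral>x. (\<integral>y. g (x, y) \<partial>?\<mu>) \<partial>D)"
      unfolding \<kappa>_def
      using D\<mu>.integral_fst'[OF bounded_measurable_integrable[OF g'(1) D\<mu>.prob_space_axioms]] by simp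
    also have "\<dots> = (\<integral>s. (\<integral>y. g (R s, y) \<partial>?\<mu>) \<partial>annealed_law)"
      unfolding D_def
      by (intro integral_distr RQ bounded_measurable_measurable
          bounded_measurable_lebesgue_integral[OF g'(2) prob_space_overlap_law])
    also have "(\<Sum>j = 2..N. \<integral>z. g z \<partial>\<kappa> j) = (\<Sum>j = 2..N. \<integral>s. g (R s, overlap s 1 j) \<partial>annealed_law)"
    proof (intro sum.cong refl)
      fix j assume j: "j \<in> {2..N}"
      then show "(\<integral>z. g z \<partial>\<kappa> j) = (\<integral>s. g (R s, overlap s 1 j) \<partial>annealed_law)"
        unfolding \<kappa>_def using g
        by (simp only: if_True, intro integral_distr pair bounded_measurable_measurable) auto
    qed
    finally show ?thesis .
  qed

  have "L1 = L2"
  proof (rule measure_eqI_generator_eq[OF Int_stable_pair_measure_generator[of ?A borel],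
        where A="\<lambda>_. space ?A \<times> UNIV"])
    show "{a \<times> b |a b. a \<in> sets ?A \<and> b \<in> sets (borel :: real measure)}
      \<subseteq> Pow (space ?A \<times> space (borel :: real measure))"
      using sets.space_closed[of ?A] by auto
    show "sets L1 = sigma_sets (space ?A \<times> space (borel :: real measure))
      {a \<times> b |a b. a \<in> sets ?A \<and> b \<in> sets borel}"
      by (simp add: L1_def sets_pair_measure)
    show "sets L2 = sigma_sets (space ?A \<times> space (borel :: real measure))
      {a \<times> b |a b. a \<in> sets ?A \<and> b \<in> sets borel}"
      unfolding sets_L2 by (simp add: sets_pair_measure)
    fix Z assume "Z \<in> {a \<times> b |a b. a \<in> sets ?A \<and> b \<in> sets (borel :: real measure)}"
    then obtain X Y where Z: "Z = X \<times> Y" and XY [measurable]: "X \<in> sets ?A" "Y \<in> sets borel"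
      by auto
    let ?f = "indicator X :: _ \<Rightarrow> real" and ?\<psi> = "indicator Y :: _ \<Rightarrow> real"
    have f: "bounded_measurable ?A ?f" and \<psi>: "bounded_measurable borel ?\<psi>"
      using XY by (auto intro: bounded_measurable_indicator)
    have fR: "bounded_measurable configurations (\<lambda>s. ?f (R s))"
      by (rule bounded_measurable_compose[OF f R])
    have \<psi>R: "bounded_measurable configurations (\<lambda>s. ?\<psi> (overlap s 1 j))" if "j \<ge> 1" for j
      by (rule bounded_measurable_compose[OF \<psi> ov[OF that]])
    have ind: "indicator Z = (\<lambda>(x, y). ?f x * ?\<psi> y)"
      unfolding Z by (auto simp: indicator_def fun_eq_iff)
    have Zm: "Z \<in> sets (?A \<Otimes>\<^sub>M borel)"
      unfolding Z using XY by auto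
    have measure_int: "measure M Z = (\<integral>z. indicat_real Z z \<partial>M)" if "Z \<in> sets M" for M
      using sets.sets_into_space[OF that] by (simp add: Int_absorb2)
    note Zb = bounded_measurable_indicator[OF Zm]
    have "real N * measure L1 Z = real N * (\<integral>s. ?f (R s) * ?\<psi> (overlap s 1 (N + 1)) \<partial>annealed_law)"
      using int_L1[OF Zb] unfolding measure_int[of L1, simplified L1_def sets_distr, OF Zm, folded L1_def]
      by (simp add: ind)
    also have "\<dots> = real N * annealed P G (\<lambda>s. ?f (R s) * ?\<psi> (overlap s 1 (N + 1)))"
      using annealed_eq[OF bounded_measurable_mult[OF fR \<psi>R[of "N + 1"]]] by simp
    also have "\<dots> = annealed P G (\<lambda>s. ?f (R s)) * annealed P G (\<lambda>s. ?\<psi> (overlap s 1 2))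
        + (\<Sum>j = 2..N. annealed P G (\<lambda>s. ?f (R s) * ?\<psi> (overlap s 1 j)))"
      using gg[unfolded ghirlanda_guerra_def, rule_format, OF N f \<psi>] N
      unfolding R_def by (simp add: field_simps)
    also have "annealed P G (\<lambda>s. ?\<psi> (overlap s 1 2)) = (\<integral>y. ?\<psi> y \<partial>?\<mu>)"
      using annealed_eq[OF \<psi>R[of 2]] integral_overlap_law[OF \<psi>] by simp
    also have "annealed P G (\<lambda>s. ?f (R s)) = (\<integral>s. ?f (R s) \<partial>annealed_law)"
      by (rule annealed_eq[OF fR])
    also have "(\<integral>s. ?f (R s) \<partial>annealed_law) * (\<integral>y. ?\<psi> y \<partial>?\<mu>)
        = (\<integral>s. (\<integral>y. ?f (R s) * ?\<psi> y \<partial>?\<mu>) \<partial>annealed_law)"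
      by simp
    also have "(\<Sum>j = 2..N. annealed P G (\<lambda>s. ?f (R s) * ?\<psi> (overlap s 1 j)))
        = (\<Sum>j = 2..N. \<integral>s. ?f (R s) * ?\<psi> (overlap s 1 j) \<partial>annealed_law)"
      by (intro sum.cong refl annealed_eq bounded_measurable_mult fR \<psi>R) auto
    also have "(\<integral>s. (\<integral>y. ?f (R s) * ?\<psi> y \<partial>?\<mu>) \<partial>annealed_law)
        + (\<Sum>j = 2..N. \<integral>s. ?f (R s) * ?\<psi> (overlap s 1 j) \<partial>annealed_law) = real N * measure L2 Z"
      using int_L2[OF Zb] unfolding measure_int[of L2, unfolded sets_L2, OF Zm] by (simp add: ind)
    finally have "measure L1 Z = measure L2 Z"
      using N by simp
    then show "emeasure L1 Z = emeasure L2 Z"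
      by (simp add: L1.emeasure_eq_measure L2.emeasure_eq_measure)
  next
    show "range (\<lambda>_. space ?A \<times> UNIV) \<subseteq> {a \<times> b |a b. a \<in> sets ?A \<and> b \<in> sets (borel :: real measure)}"
      by (auto intro!: exI[of _ "space ?A"] exI[of _ "UNIV :: real set"])
  qed auto
  then show ?thesis
    using int_L1[OF h] int_L2[OF h] by simp
qed

text \<open>Exchangeability of the replicas, for the transposition of 1 and \<open>l\<close>.\<close>

lemma integral_annealed_law_transpose:
  assumes l: "l \<ge> 1" and \<phi>: "bounded_measurable configurations \<phi>"
  shows "(\<integral>s. \<phi> (\<lambda>i\<in>{1..}. s (Transposition.transpose 1 l i)) \<partial>annealed_law) =
    (\<integral>s. \<phi> s \<partial>annealed_law)"
proof -
  let ?\<pi> = "Transposition.transpose 1 l :: nat \<Rightarrow> nat"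
  let ?T = "\<lambda>s. \<lambda>i\<in>{1..}. s (?\<pi> i)"
  have \<pi>: "?\<pi> \<in> {1..} \<rightarrow> {1..}"
    using l by (auto simp: Transposition.transpose_def)
  have T: "?T \<in> configurations \<rightarrow>\<^sub>M configurations"
    using \<pi> by (intro measurable_restrict measurable_component_singleton) auto
  have "(\<integral>s. \<phi> (?T s) \<partial>annealed_law) = annealed P G (\<lambda>s. \<phi> (?T s))"
    by (rule annealed_eq[OF bounded_measurable_compose[OF \<phi> T], symmetric])
  also have "\<dots> = annealed P G \<phi>"
    unfolding annealed_def
  proof (rule Bochner_Integration.integral_cong[OF refl])
    fix w assume w: "w \<in> space P"
    have sets: "sets (\<Pi>\<^sub>M i\<in>{1::nat..}. G w) = sets configurations"
      by (intro sets_PiM_cong sets_G w) auto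
    have T': "?T \<in> (\<Pi>\<^sub>M i\<in>{1..}. G w) \<rightarrow>\<^sub>M (\<Pi>\<^sub>M i\<in>{1..}. G w)"
      using T by (simp only: measurable_cong_sets[OF sets sets])
    have "(\<integral>s. \<phi> (?T s) \<partial>(\<Pi>\<^sub>M i\<in>{1..}. G w)) =
      (\<integral>s. \<phi> s \<partial>distr (\<Pi>\<^sub>M i\<in>{1..}. G w) (\<Pi>\<^sub>M i\<in>{1..}. G w) ?T)"
      using \<phi> bounded_measurable_cong_sets[OF sets]
      by (intro integral_distr[symmetric] T' bounded_measurable_measurable) blast
    also have "distr (\<Pi>\<^sub>M i\<in>{1..}. G w) (\<Pi>\<^sub>M i\<in>{1..}. G w) ?T = (\<Pi>\<^sub>M i\<in>{1..}. G w)"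
      using \<pi> by (intro distr_PiM_reindex prob_space_G w) (auto intro: inj_on_subset[OF inj_transpose])
    finally show "(\<integral>s. \<phi> (?T s) \<partial>(\<Pi>\<^sub>M i\<in>{1..}. G w)) = (\<integral>s. \<phi> s \<partial>(\<Pi>\<^sub>M i\<in>{1..}. G w))" .
  qed
  also have "\<dots> = (\<integral>s. \<phi> s \<partial>annealed_law)"
    by (rule annealed_eq[OF \<phi>])
  finally show ?thesis .
qed

lemma bounded_measurable_overlaps:
  fixes N
  assumes h: "bounded_measurable (real_arrays ({1..N} \<times> {1..N}) \<Otimes>\<^sub>M borel) h" and "i \<ge> 1" "j \<ge> 1"
  shows "bounded_measurable configurations (\<lambda>s. h (overlap_array ({1..N} \<times> {1..N}) s, overlap s i j))"
  using assms(2,3)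
  by (intro bounded_measurable_compose[OF h] measurable_Pair overlap_array_measurable overlap_measurable) auto

lemma bounded_measurable_overlaps_integral:
  fixes N
  assumes h: "bounded_measurable (real_arrays ({1..N} \<times> {1..N}) \<Otimes>\<^sub>M borel) h"
  shows "bounded_measurable configurations
    (\<lambda>s. \<integral>y. h (overlap_array ({1..N} \<times> {1..N}) s, y) \<partial>overlap_law P G)"
proof -
  have "bounded_measurable (real_arrays ({1..N} \<times> {1..N}) \<Otimes>\<^sub>M overlap_law P G) h"
    using h bounded_measurable_cong_sets[OF sets_pair_measure_cong[OF refl sets_overlap_law]] by blast
  from bounded_measurable_lebesgue_integral[OF this prob_space_overlap_law] show ?thesis
    by (rule bounded_measurable_compose) (intro overlap_array_measurable, auto)
qed

lemma ghirlanda_guerra_replica: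
  fixes N h
  defines "R \<equiv> overlap_array ({1..N} \<times> {1..N}) :: (nat \<Rightarrow> 'h) \<Rightarrow> _"
  assumes gg: "ghirlanda_guerra P G" and N: "N \<ge> 2"
    and h: "bounded_measurable (real_arrays ({1..N} \<times> {1..N}) \<Otimes>\<^sub>M borel) h"
    and l: "l \<in> {1..N}"
  shows "real N * (\<integral>s. h (R s, overlap s l (N + 1)) \<partial>annealed_law) =
    (\<integral>s. (\<integral>y. h (R s, y) \<partial>overlap_law P G) \<partial>annealed_law)
    + (\<Sum>j \<in> {1..N} - {l}. \<integral>s. h (R s, overlap s l j) \<partial>annealed_law)"
proof -
  let ?\<pi> = "Transposition.transpose 1 l :: nat \<Rightarrow> nat"
  let ?I = "{1..N} \<times> {1..N}"
  let ?T = "\<lambda>s. \<lambda>i\<in>{1..}. s (?\<pi> i)"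
  let ?\<rho> = "\<lambda>r. \<lambda>(i, j)\<in>?I. r (?\<pi> i, ?\<pi> j)"
  let ?h = "\<lambda>(r, y). h (?\<rho> r, y)"
  have l1: "l \<ge> 1" using l by auto
  have \<pi>: "?\<pi> i \<in> {1..N}" if "i \<in> {1..N}" for i
    using that l by (auto simp: Transposition.transpose_def)
  have \<rho>: "?\<rho> \<in> real_arrays ?I \<rightarrow>\<^sub>M real_arrays ?I"
  proof (intro measurable_restrict)
    fix p assume "p \<in> ?I"
    then show "(\<lambda>r. case p of (i, j) \<Rightarrow> r (?\<pi> i, ?\<pi> j)) \<in> borel_measurable (real_arrays ?I)"
      using \<pi> by (cases p) (auto intro!: measurable_component_singleton)
  qed
  have "(\<lambda>(r, y). (?\<rho> r, y)) \<in> real_arrays ?I \<Otimes>\<^sub>M (borel :: real measure) \<rightarrow>\<^sub>M real_arrays ?I \<Otimes>\<^sub>M borel"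
    using \<rho> by measurable
  from bounded_measurable_compose[OF h this]
  have h': "bounded_measurable (real_arrays ?I \<Otimes>\<^sub>M borel) ?h"
    by (simp add: case_prod_unfold)
  have RT: "?\<rho> (R s) = R (?T s)" for s
    unfolding R_def overlap_array_def overlap_def
    using \<pi> by (auto simp: fun_eq_iff restrict_def)
  have ov: "overlap s 1 j = overlap (?T s) l (?\<pi> j)" if "j \<ge> 1" for s :: "nat \<Rightarrow> 'h" and j
    using that l1 by (auto simp: overlap_def Transposition.transpose_def)
  note T = integral_annealed_law_transpose[OF l1]
  have 1: "(\<integral>s. ?h (R s, overlap s 1 j) \<partial>annealed_law) = (\<integral>s. h (R s, overlap s l (?\<pi> j)) \<partial>annealed_law)"
    if "j \<ge> 1" for j
  proof -
    have "?\<pi> j \<ge> 1"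
      using that l1 by (auto simp: Transposition.transpose_def)
    from T[OF bounded_measurable_overlaps[OF h l1 this]] show ?thesis
      unfolding prod.case RT ov[OF that] by (simp only: R_def)
  qed
  have 2: "(\<integral>s. (\<integral>y. ?h (R s, y) \<partial>overlap_law P G) \<partial>annealed_law) =
    (\<integral>s. (\<integral>y. h (R s, y) \<partial>overlap_law P G) \<partial>annealed_law)"
    using T[OF bounded_measurable_overlaps_integral[OF h]] unfolding prod.case RT by (simp only: R_def)
  have "real N * (\<integral>s. h (R s, overlap s l (?\<pi> (N + 1))) \<partial>annealed_law) =
    (\<integral>s. (\<integral>y. h (R s, y) \<partial>overlap_law P G) \<partial>annealed_law)
    + (\<Sum>j = 2..N. \<integral>s. h (R s, overlap s l (?\<pi> j)) \<partial>annealed_law)"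
    using ghirlanda_guerra_joint[OF gg N h'] 1 unfolding R_def[symmetric] 2 by simp
  also have "?\<pi> (N + 1) = N + 1"
    using l by (auto simp: Transposition.transpose_def)
  also have "(\<Sum>j = 2..N. \<integral>s. h (R s, overlap s l (?\<pi> j)) \<partial>annealed_law) =
    (\<Sum>j \<in> {1..N} - {l}. \<integral>s. h (R s, overlap s l j) \<partial>annealed_law)"
    using l by (intro sum.reindex_bij_witness[where i="?\<pi>" and j="?\<pi>"])
      (auto simp: Transposition.transpose_def)
  finally show ?thesis .
qed

end

section \<open>The averaged identity for \<open>F_bar\<close>\<close>

text \<open>The setting of the theorem; \<open>F x s\<close> is \<open>F_bar\<close> with \<open>\<sigma> = x\<close> and \<open>\<sigma>\<^sup>l = s l\<close>.\<close>

locale cavity_functions = random_measure P G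
  for P :: "'w measure"
    and G :: "'w \<Rightarrow> 'h::{real_inner, complete_space, second_countable_topology} measure" +
  fixes n :: nat and f :: "nat \<Rightarrow> (nat \<times> nat \<Rightarrow> real) \<times> real \<Rightarrow> real"
  assumes ghirlanda_guerra: "ghirlanda_guerra P G"
    and n: "n \<ge> 1"
    and f: "\<And>l. l \<in> {1..n} \<Longrightarrow> bounded_measurable (real_arrays (pairs n) \<Otimes>\<^sub>M borel) (f l)"
begin

abbreviation F :: "'h \<Rightarrow> (nat \<Rightarrow> 'h) \<Rightarrow> real" where
  "F \<equiv> F_bar (overlap_law P G) n f"

text \<open>
  \<open>F_bar\<close> as a function of the overlaps \<open>r\<close> of the first \<open>n\<close> replicas, self-overlaps included, and of the
  scalar products \<open>v l = \<sigma> \<bullet> \<sigma>\<^sup>l\<close>. For \<open>\<sigma> = \<sigma>\<^sup>k\<close> it is thus a function of the overlaps of the replicas,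
  to which the Ghirlanda-Guerra identities apply.
\<close>

definition F_array :: "(nat \<times> nat \<Rightarrow> real) \<times> (nat \<Rightarrow> real) \<Rightarrow> real" where
  "F_array = (\<lambda>(r, v). (\<Sum>l = 1..n. f l (restrict r (pairs n), v l)) - 1 / real n * (\<Sum>j = 1..n.
     (\<Sum>l = 1..n. f l (restrict r (pairs n), r (j, l))) - f j (restrict r (pairs n), r (j, j))
       + (\<integral>y. f j (restrict r (pairs n), y) \<partial>overlap_law P G)))"

lemma pairs_subset: "n \<le> N \<Longrightarrow> pairs n \<subseteq> {1..N} \<times> {1..N}"
  by (auto simp: pairs_def)

lemma restrict_overlap_array:
  "J \<subseteq> I \<Longrightarrow> restrict (overlap_array I s) J = overlap_array J s"
  by (auto simp: overlap_array_def fun_eq_iff restrict_def)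

lemma F_eq_F_array:
  "F x s = F_array (overlap_array ({1..n} \<times> {1..n}) s, \<lambda>l\<in>{1..n}. x \<bullet> s l)"
proof -
  have "overlap_array ({1..n} \<times> {1..n}) s (j, l) = s j \<bullet> s l" if "j \<in> {1..n}" "l \<in> {1..n}" for j l
    using that by (simp add: overlap_array_def overlap_def)
  moreover have "restrict (overlap_array ({1..n} \<times> {1..n}) s) (pairs n) = overlap_array (pairs n) s"
    by (rule restrict_overlap_array[OF pairs_subset]) simp
  ultimately show ?thesis
    unfolding F_bar_def F_repl_def F_sum_def F_array_def by simp
qed

lemma bounded_measurable_F_array:
  "bounded_measurable (real_arrays ({1..n} \<times> {1..n}) \<Otimes>\<^sub>M (\<Pi>\<^sub>M l\<in>{1..n}. borel)) F_array"
proof -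
  let ?A = "real_arrays ({1..n} \<times> {1..n})"
  let ?M = "?A \<Otimes>\<^sub>M (\<Pi>\<^sub>M l\<in>{1..n}. (borel :: real measure))"
  have r: "(\<lambda>z. restrict (fst z) (pairs n)) \<in> ?M \<rightarrow>\<^sub>M real_arrays (pairs n)"
    by (intro measurable_compose[OF measurable_fst measurable_restrict_subset] pairs_subset) simp
  have 1: "bounded_measurable ?M (\<lambda>z. f l (restrict (fst z) (pairs n), snd z l))" if "l \<in> {1..n}" for l
    using that
    by (intro bounded_measurable_compose[OF f] measurable_Pair r
        measurable_compose[OF measurable_snd measurable_component_singleton])
  have 2: "bounded_measurable ?M (\<lambda>z. f l (restrict (fst z) (pairs n), fst z (j, l)))"
    if "l \<in> {1..n}" "j \<in> {1..n}" for j l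
    using that
    by (intro bounded_measurable_compose[OF f] measurable_Pair r
        measurable_compose[OF measurable_fst measurable_component_singleton]) auto
  have 3: "bounded_measurable ?M (\<lambda>z. \<integral>y. f l (restrict (fst z) (pairs n), y) \<partial>overlap_law P G)"
    if "l \<in> {1..n}" for l
  proof -
    have "bounded_measurable (real_arrays (pairs n) \<Otimes>\<^sub>M overlap_law P G) (f l)"
      using f[OF that] bounded_measurable_cong_sets[OF sets_pair_measure_cong[OF refl sets_overlap_law]]
      by blast
    from bounded_measurable_lebesgue_integral[OF this prob_space_overlap_law] show ?thesis
      by (rule bounded_measurable_compose[OF _ r])
  qed
  show ?thesis
    unfolding F_array_def case_prod_unfold
    by (intro bounded_measurable_diff bounded_measurable_add bounded_measurable_sum
        bounded_measurable_mult bounded_measurable_const 1 2 3)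
qed

lemma F_array_replica_measurable:
  assumes "n \<le> N" "k \<in> {1..N}"
  shows "bounded_measurable (real_arrays ({1..N} \<times> {1..N}))
    (\<lambda>r. F_array (restrict r ({1..n} \<times> {1..n}), \<lambda>l\<in>{1..n}. r (k, l)))"
  using assms
  by (intro bounded_measurable_compose[OF bounded_measurable_F_array] measurable_Pair
      measurable_restrict_subset measurable_restrict measurable_component_singleton) auto

lemma F_replica_eq:
  assumes "n \<le> N" "k \<in> {1..N}"
  shows "F (s k) s = F_array (restrict (overlap_array ({1..N} \<times> {1..N}) s) ({1..n} \<times> {1..n}),
    \<lambda>l\<in>{1..n}. overlap_array ({1..N} \<times> {1..N}) s (k, l))"
proof -
  have "overlap_array ({1..N} \<times> {1..N}) s (k, l) = s k \<bullet> s l" if "l \<in> {1..n}" for l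
    using that assms by (simp add: overlap_array_def overlap_def)
  then show ?thesis
    using assms unfolding F_eq_F_array
    by (subst restrict_overlap_array) (auto cong: restrict_cong)
qed

lemma bounded_measurable_F_replica:
  assumes "k \<ge> 1"
  shows "bounded_measurable configurations (\<lambda>s. F (s k) s)"
proof -
  let ?N = "max n k"
  have "overlap_array ({1..?N} \<times> {1..?N}) \<in> configurations \<rightarrow>\<^sub>M real_arrays ({1..?N} \<times> {1..?N})"
    by (intro overlap_array_measurable) auto
  from bounded_measurable_compose[OF F_array_replica_measurable this, of k]
  show ?thesis
    using assms by (subst F_replica_eq[of ?N k]) auto
qed

text \<open>
  The bracket is a sum over \<open>l \<le> n\<close> of the terms of the Ghirlanda-Guerra identity for replica \<open>l\<close> and the
  function \<open>f\<^sub>l\<close>. Let \<open>c\<close> be the quantity, not depending on \<open>\<sigma>\<close>, that is subtracted in \<open>F_bar\<close>. It is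
  subtracted \<open>N\<close> times in the first term of the bracket and \<open>N - n\<close> times in the sum. The difference \<open>n c\<close>
  consists of the integrals against \<open>\<mu>\<close> and of the overlaps among the first \<open>n\<close> replicas.
\<close>

lemma ghirlanda_guerra_F:
  fixes N g
  defines "R \<equiv> overlap_array ({1..N} \<times> {1..N}) :: (nat \<Rightarrow> 'h) \<Rightarrow> _"
  assumes N: "n \<le> N" "2 \<le> N" and g: "bounded_measurable (real_arrays ({1..N} \<times> {1..N})) g"
  shows "(\<integral>s. g (R s) * (real N * F (s (N + 1)) s - (\<Sum>k = n+1..N. F (s k) s)) \<partial>annealed_law) = 0"
proof -
  let ?I = "{1..N} \<times> {1..N}" and ?\<mu> = "overlap_law P G"
  define h where "h l = (\<lambda>(r, y). g r * f l (restrict r (pairs n), y))" for l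
  have h: "bounded_measurable (real_arrays ?I \<Otimes>\<^sub>M borel) (h l)" if l: "l \<in> {1..n}" for l
  proof -
    have "(\<lambda>z. (restrict (fst z) (pairs n), snd z)) \<in>
        real_arrays ?I \<Otimes>\<^sub>M (borel :: real measure) \<rightarrow>\<^sub>M real_arrays (pairs n) \<Otimes>\<^sub>M borel"
      by (intro measurable_Pair measurable_compose[OF measurable_fst measurable_restrict_subset]
          pairs_subset N measurable_snd)
    then show ?thesis
      unfolding h_def case_prod_unfold
      by (intro bounded_measurable_mult bounded_measurable_compose[OF g measurable_fst]
          bounded_measurable_compose[OF f[OF l]])
  qed
  have int: "integrable annealed_law \<phi>" if "bounded_measurable configurations \<phi>" for \<phi> :: "_ \<Rightarrow> real"
    using that prob_space_annealed_law bounded_measurable_cong_sets[OF sets_annealed_law]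
    by (intro bounded_measurable_integrable) auto
  have int_h: "integrable annealed_law (\<lambda>s. h l (R s, overlap s l j))"
    if "l \<in> {1..n}" "j \<ge> 1" for l j
    unfolding R_def using that by (intro int bounded_measurable_overlaps h) auto
  have int_\<mu>: "integrable annealed_law (\<lambda>s. \<integral>y. h l (R s, y) \<partial>?\<mu>)" if "l \<in> {1..n}" for l
    unfolding R_def using that by (intro int bounded_measurable_overlaps_integral h) auto
  have "g (R s) * (real N * F (s (N + 1)) s - (\<Sum>k = n+1..N. F (s k) s)) =
    (\<Sum>l = 1..n. real N * h l (R s, overlap s l (N + 1)) - (\<integral>y. h l (R s, y) \<partial>?\<mu>)
      - (\<Sum>j \<in> {1..N} - {l}. h l (R s, overlap s l j)))" for s
  proof -
    let ?r = "overlap_array (pairs n) s"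
    define a where "a l j = f l (?r, overlap s l j)" for l j
    define b where "b l = (\<integral>y. f l (?r, y) \<partial>?\<mu>)" for l
    define c where "c = 1 / real n * (\<Sum>j = 1..n. (\<Sum>l = 1..n. a l j) - a j j + b j)"
    have F: "F (s k) s = (\<Sum>l = 1..n. a l k) - c" for k
      unfolding F_bar_def F_repl_def F_sum_def a_def b_def c_def overlap_def
      by (simp add: inner_commute)
    have "(\<Sum>k = n+1..N. F (s k) s) = (\<Sum>l = 1..n. \<Sum>k = n+1..N. a l k) - (real N - real n) * c"
      unfolding F using N by (subst sum.swap) (simp add: sum_subtractf of_nat_diff)
    moreover have "real n * c = (\<Sum>l = 1..n. (\<Sum>j = 1..n. a l j) - a l l + b l)"
      using n unfolding c_def
      by (simp add: sum_subtractf sum.distrib sum.swap[of "\<lambda>j l. a l j"])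
    ultimately have "real N * F (s (N + 1)) s - (\<Sum>k = n+1..N. F (s k) s) =
      (\<Sum>l = 1..n. real N * a l (N + 1) - b l - ((\<Sum>j = 1..n. a l j) + (\<Sum>k = n+1..N. a l k) - a l l))"
      unfolding F[of "N + 1"] by (simp add: sum_subtractf sum.distrib sum_distrib_left algebra_simps)
    also have "\<dots> = (\<Sum>l = 1..n. real N * a l (N + 1) - b l - (\<Sum>j \<in> {1..N} - {l}. a l j))"
    proof (intro sum.cong refl arg_cong2[where f="(-)"])
      fix l assume l: "l \<in> {1..n}"
      have "(\<Sum>j = 1..n. a l j) + (\<Sum>k = n+1..N. a l k) = (\<Sum>j = 1..N. a l j)"
        using N(1) by (subst sum.union_disjoint[symmetric]) (auto intro!: sum.cong)
      also have "\<dots> = a l l + (\<Sum>j \<in> {1..N} - {l}. a l j)"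
        using l N(1) by (intro sum.remove) auto
      finally show "(\<Sum>j = 1..n. a l j) + (\<Sum>k = n+1..N. a l k) - a l l = (\<Sum>j \<in> {1..N} - {l}. a l j)"
        by simp
    qed
    finally have *: "real N * F (s (N + 1)) s - (\<Sum>k = n+1..N. F (s k) s) =
      (\<Sum>l = 1..n. real N * a l (N + 1) - b l - (\<Sum>j \<in> {1..N} - {l}. a l j))" .
    have "h l (R s, y) = g (R s) * f l (?r, y)" for l y
      unfolding h_def R_def by (simp only: prod.case restrict_overlap_array[OF pairs_subset[OF N(1)]])
    then show ?thesis
      unfolding * a_def b_def by (simp add: sum_distrib_left right_diff_distrib mult.left_commute)
  qed
  then have "(\<integral>s. g (R s) * (real N * F (s (N + 1)) s - (\<Sum>k = n+1..N. F (s k) s)) \<partial>annealed_law) =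
    (\<integral>s. (\<Sum>l = 1..n. real N * h l (R s, overlap s l (N + 1)) - (\<integral>y. h l (R s, y) \<partial>?\<mu>)
      - (\<Sum>j \<in> {1..N} - {l}. h l (R s, overlap s l j))) \<partial>annealed_law)"
    by simp
  also have "\<dots> = (\<Sum>l = 1..n. real N * (\<integral>s. h l (R s, overlap s l (N + 1)) \<partial>annealed_law)
      - (\<integral>s. (\<integral>y. h l (R s, y) \<partial>?\<mu>) \<partial>annealed_law)
      - (\<Sum>j \<in> {1..N} - {l}. \<integral>s. h l (R s, overlap s l j) \<partial>annealed_law))"
  proof -
    have 1: "integrable annealed_law (\<lambda>s. real N * h l (R s, overlap s l (N + 1)))" if "l \<in> {1..n}" for l
      using int_h[OF that, of "N + 1"] by simp
    have 2: "integrable annealed_law (\<lambda>s. \<Sum>j \<in> {1..N} - {l}. h l (R s, overlap s l j))"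
      if "l \<in> {1..n}" for l
      using int_h[OF that] by (intro Bochner_Integration.integrable_sum) auto
    have 3: "(\<integral>s. (\<Sum>j \<in> {1..N} - {l}. h l (R s, overlap s l j)) \<partial>annealed_law) =
      (\<Sum>j \<in> {1..N} - {l}. \<integral>s. h l (R s, overlap s l j) \<partial>annealed_law)" if "l \<in> {1..n}" for l
      using int_h[OF that] by (intro Bochner_Integration.integral_sum) auto
    note diff = Bochner_Integration.integral_diff Bochner_Integration.integrable_diff
    show ?thesis
      by (subst Bochner_Integration.integral_sum)
         (auto intro!: sum.cong diff 1 2 int_\<mu> simp: diff(1)[OF diff(2)[OF 1 int_\<mu>] 2] diff(1)[OF 1 int_\<mu>] 3
           simp del: One_nat_def)
  qed
  also have "\<dots> = 0"
    using ghirlanda_guerra_replica[OF ghirlanda_guerra N(2) h, folded R_def] N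
    by (intro sum.neutral) auto
  finally show ?thesis .
qed

section \<open>Conditioning on the first \<open>n\<close> replicas\<close>

lemma F_restrict: "F x (restrict s {1..n}) = F x s"
proof -
  have "overlap_array ({1..n} \<times> {1..n}) (restrict s {1..n}) = overlap_array ({1..n} \<times> {1..n}) s"
    by (auto simp: overlap_array_def overlap_def fun_eq_iff restrict_def)
  then show ?thesis
    unfolding F_eq_F_array by (simp cong: restrict_cong)
qed

lemma bounded_measurable_F:
  "bounded_measurable (unit_ball_borel \<Otimes>\<^sub>M (\<Pi>\<^sub>M i\<in>{1..n}. unit_ball_borel)) (\<lambda>z. F (fst z) (snd z))"
proof -
  let ?M = "unit_ball_borel \<Otimes>\<^sub>M (\<Pi>\<^sub>M i\<in>{1..n}. unit_ball_borel) :: ('h \<times> (nat \<Rightarrow> 'h)) measure"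
  have "(\<lambda>z. fst z \<bullet> snd z l) \<in> borel_measurable ?M" if "l \<in> {1..n}" for l
  proof -
    have "(\<lambda>z. (fst z, snd z l)) \<in> ?M \<rightarrow>\<^sub>M unit_ball_borel \<Otimes>\<^sub>M unit_ball_borel"
      using that by (intro measurable_Pair measurable_fst measurable_compose[OF measurable_snd]
          measurable_component_singleton)
    from measurable_compose[OF this inner_measurable] show ?thesis
      by simp
  qed
  then show ?thesis
    unfolding F_eq_F_array
    by (intro bounded_measurable_compose[OF bounded_measurable_F_array] measurable_Pair
        measurable_restrict measurable_compose[OF measurable_snd overlap_array_measurable]) auto
qed

text \<open>
  The quantities \<open>p\<close>, \<open>e\<close> and \<open>a\<close>: the \<open>G\<close>-measure of \<open>F \<ge> 0\<close> (written as an integral), and the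
  \<open>G\<close>-integrals of \<open>F\<close> and of its positive part.
\<close>

definition nonneg_mass :: "'w \<Rightarrow> (nat \<Rightarrow> 'h) \<Rightarrow> real" where
  "nonneg_mass w s = (\<integral>x. of_bool (F x s \<ge> 0) \<partial>G w)"

definition mean :: "'w \<Rightarrow> (nat \<Rightarrow> 'h) \<Rightarrow> real" where
  "mean w s = (\<integral>x. F x s \<partial>G w)"

definition positive_part_mean :: "'w \<Rightarrow> (nat \<Rightarrow> 'h) \<Rightarrow> real" where
  "positive_part_mean w s = (\<integral>x. of_bool (F x s \<ge> 0) * F x s \<partial>G w)"

text \<open>The quantity \<open>(n + m) p\<^sup>m e - m p\<^sup>m\<^sup>-\<^sup>1 a\<close> for \<open>m = i + 1\<close>.\<close>

definition moment_difference :: "nat \<Rightarrow> 'w \<Rightarrow> (nat \<Rightarrow> 'h) \<Rightarrow> real" where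
  "moment_difference i w s = real (n + Suc i) * nonneg_mass w s ^ Suc i * mean w s
     - real (Suc i) * nonneg_mass w s ^ i * positive_part_mean w s"

text \<open>
  The integrand of the averaged identity when \<open>g\<close> is the indicator that \<open>F(\<sigma>\<^sup>k) \<ge> 0\<close> for the \<open>m\<close>
  replicas following the first \<open>n\<close>.
\<close>

definition test :: "nat \<Rightarrow> (nat \<Rightarrow> 'h) \<Rightarrow> real" where
  "test m s = (\<Prod>k = n+1..n+m. of_bool (F (s k) s \<ge> 0)) *
     (real (n + m) * F (s (n + m + 1)) s - (\<Sum>k = n+1..n+m. F (s k) s))"

lemma bounded_measurable_test: "bounded_measurable configurations (test m)"
  unfolding test_def
  by (intro bounded_measurable_mult bounded_measurable_prod bounded_measurable_diff
      bounded_measurable_sum bounded_measurable_const bounded_measurable_F_replica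
      bounded_measurable_of_bool_nonneg) auto

lemma integral_test:
  assumes "m \<ge> 1"
  shows "(\<integral>w. (\<integral>s. test m s \<partial>(\<Pi>\<^sub>M i\<in>{1..}. G w)) \<partial>P) = 0"
proof -
  let ?I = "{1..n + m} \<times> {1..n + m}"
  let ?U = "\<lambda>k r. F_array (restrict r ({1..n} \<times> {1..n}), \<lambda>l\<in>{1..n}. r (k, l))"
  define g where "g r = (\<Prod>k = n+1..n+m. of_bool (?U k r \<ge> 0) :: real)" for r
  have "bounded_measurable (real_arrays ?I) g"
    unfolding g_def
    by (intro bounded_measurable_prod bounded_measurable_of_bool_nonneg F_array_replica_measurable) auto
  moreover have "g (overlap_array ?I s) = (\<Prod>k = n+1..n+m. of_bool (F (s k) s \<ge> 0))" for s
    unfolding g_def by (intro prod.cong refl, subst F_replica_eq[of "n + m"]) auto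
  ultimately have "(\<integral>s. test m s \<partial>annealed_law) = 0"
    using ghirlanda_guerra_F[of "n + m" g] n assms unfolding test_def by simp
  then show ?thesis
    using annealed_eq[OF bounded_measurable_test, of m] unfolding annealed_def by simp
qed

lemma bounded_measurable_F_replicas:
  assumes w: "w \<in> space P"
  shows "bounded_measurable (G w \<Otimes>\<^sub>M (\<Pi>\<^sub>M i\<in>{1..n}. G w)) (\<lambda>z. F (fst z) (snd z))"
proof -
  have "sets (G w \<Otimes>\<^sub>M (\<Pi>\<^sub>M i\<in>{1..n}. G w)) = sets (unit_ball_borel \<Otimes>\<^sub>M (\<Pi>\<^sub>M i\<in>{1..n}. unit_ball_borel))"
    by (intro sets_pair_measure_cong sets_PiM_cong sets_G[OF w]) auto
  from bounded_measurable_cong_sets[OF this] bounded_measurable_F show ?thesis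
    by blast
qed

lemma bounded_measurable_nonneg_mass:
  "w \<in> space P \<Longrightarrow> bounded_measurable (\<Pi>\<^sub>M i\<in>{1..n}. G w) (nonneg_mass w)"
  and bounded_measurable_mean:
  "w \<in> space P \<Longrightarrow> bounded_measurable (\<Pi>\<^sub>M i\<in>{1..n}. G w) (mean w)"
  and bounded_measurable_positive_part_mean:
  "w \<in> space P \<Longrightarrow> bounded_measurable (\<Pi>\<^sub>M i\<in>{1..n}. G w) (positive_part_mean w)"
proof -
  assume w: "w \<in> space P"
  note F = bounded_measurable_F_replicas[OF w]
  note int = bounded_measurable_lebesgue_integral_fst[OF _ prob_space_G[OF w]]
  note F0 = bounded_measurable_of_bool_nonneg[OF F]
  show "bounded_measurable (\<Pi>\<^sub>M i\<in>{1..n}. G w) (nonneg_mass w)"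
    using int[OF F0] unfolding nonneg_mass_def by simp
  show "bounded_measurable (\<Pi>\<^sub>M i\<in>{1..n}. G w) (mean w)"
    using int[OF F] unfolding mean_def by simp
  show "bounded_measurable (\<Pi>\<^sub>M i\<in>{1..n}. G w) (positive_part_mean w)"
    using int[OF bounded_measurable_mult[OF F0 F]] unfolding positive_part_mean_def by simp
qed

lemma bounded_measurable_moment_difference:
  "w \<in> space P \<Longrightarrow> bounded_measurable (\<Pi>\<^sub>M i\<in>{1..n}. G w) (moment_difference i w)"
  unfolding moment_difference_def
  by (intro bounded_measurable_diff bounded_measurable_mult bounded_measurable_const
      bounded_measurable_power bounded_measurable_nonneg_mass bounded_measurable_mean
      bounded_measurable_positive_part_mean)

text \<open>
  Each term of \<open>test\<close> is a product of functions of \<open>\<sigma>\<^sup>k\<close>, \<open>n < k \<le> n + m + 1\<close>, given the first \<open>n\<close>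
  replicas. In the first term the factor \<open>F(\<sigma>\<^sup>N\<^sup>+\<^sup>1)\<close> is separate from the \<open>m\<close> indicators and contributes
  \<open>p\<^sup>m e\<close>; in the others \<open>F(\<sigma>\<^sup>j)\<close> meets the indicator for the same replica and contributes \<open>p\<^sup>m\<^sup>-\<^sup>1 a\<close>.
\<close>

lemma integral_test_replicas:
  assumes w: "w \<in> space P"
  shows "(\<integral>s. test (Suc i) s \<partial>(\<Pi>\<^sub>M i\<in>{1..}. G w)) =
    (\<integral>s. moment_difference i w s \<partial>(\<Pi>\<^sub>M i\<in>{1..n}. G w))"
proof -
  let ?M = "G w" and ?K = "\<Pi>\<^sub>M i\<in>{1::nat..}. G w" and ?L = "\<Pi>\<^sub>M i\<in>{1..n}. G w"
  interpret M: prob_space ?M by (rule prob_space_G[OF w])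
  interpret K: prob_space ?K by (rule prob_space_PiM[OF M.prob_space_axioms])
  interpret L: prob_space ?L by (rule prob_space_PiM[OF M.prob_space_axioms])
  define m where "m = Suc i"
  define J where "J = {n+1..n+m}"
  have J: "finite J" "card J = m" "n + m + 1 \<notin> J"
    by (auto simp: J_def)
  have sets_K: "sets ?K = sets configurations"
    by (intro sets_PiM_cong sets_G[OF w]) auto
  note F = bounded_measurable_F_replicas[OF w]
  note F0 = bounded_measurable_of_bool_nonneg[OF F]
  have FK: "bounded_measurable ?K (\<lambda>s. F (s k) s)" if "k \<ge> 1" for k
    using bounded_measurable_F_replica[OF that] bounded_measurable_cong_sets[OF sets_K] by blast
  let ?\<Phi> = "\<lambda>s. \<Prod>k\<in>J. of_bool (F (s k) s \<ge> 0) :: real"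
  have \<Phi>: "bounded_measurable ?K ?\<Phi>"
    by (intro bounded_measurable_prod bounded_measurable_of_bool_nonneg FK) (auto simp: J_def)
  have 1: "(\<integral>s. ?\<Phi> s * F (s (n + m + 1)) s \<partial>?K) = (\<integral>s. nonneg_mass w s ^ m * mean w s \<partial>?L)"
  proof -
    define q :: "nat \<Rightarrow> 'h \<times> (nat \<Rightarrow> 'h) \<Rightarrow> real" where
      "q k = (if k = n + m + 1 then (\<lambda>z. F (fst z) (snd z)) else (\<lambda>z. of_bool (F (fst z) (snd z) \<ge> 0)))" for k
    have "(\<integral>s. ?\<Phi> s * F (s (n + m + 1)) s \<partial>?K) =
      (\<integral>s. (\<Prod>k\<in>insert (n + m + 1) J. q k (s k, restrict s {1..n})) \<partial>?K)"
    proof (intro Bochner_Integration.integral_cong refl)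
      fix s
      have "(\<Prod>k\<in>J. q k (s k, restrict s {1..n})) = ?\<Phi> s"
        using J(3) by (intro prod.cong refl) (auto simp: q_def F_restrict simp del: One_nat_def)
      then show "?\<Phi> s * F (s (n + m + 1)) s = (\<Prod>k\<in>insert (n + m + 1) J. q k (s k, restrict s {1..n}))"
        unfolding prod.insert[OF J(1,3)] by (simp add: q_def F_restrict del: One_nat_def)
    qed
    also have "\<dots> = (\<integral>s. (\<Prod>k\<in>insert (n + m + 1) J. \<integral>x. q k (x, s) \<partial>?M) \<partial>?L)"
      using F F0 by (intro integral_PiM_conditional_prod M.prob_space_axioms) (auto simp: J_def q_def)
    also have "\<dots> = (\<integral>s. nonneg_mass w s ^ m * mean w s \<partial>?L)"
    proof (intro Bochner_Integration.integral_cong refl)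
      fix s
      have "(\<Prod>k\<in>J. \<integral>x. q k (x, s) \<partial>?M) = (\<Prod>k\<in>J. nonneg_mass w s)"
        using J(3) by (intro prod.cong refl) (auto simp: q_def nonneg_mass_def)
      then show "(\<Prod>k\<in>insert (n + m + 1) J. \<integral>x. q k (x, s) \<partial>?M) = nonneg_mass w s ^ m * mean w s"
        using J by (simp add: q_def mean_def)
    qed
    finally show ?thesis .
  qed
  have 2: "(\<integral>s. ?\<Phi> s * F (s j) s \<partial>?K) = (\<integral>s. nonneg_mass w s ^ i * positive_part_mean w s \<partial>?L)"
    if j: "j \<in> J" for j
  proof -
    define q :: "nat \<Rightarrow> 'h \<times> (nat \<Rightarrow> 'h) \<Rightarrow> real" where
      "q k = (if k = j then (\<lambda>z. of_bool (F (fst z) (snd z) \<ge> 0) * F (fst z) (snd z))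
        else (\<lambda>z. of_bool (F (fst z) (snd z) \<ge> 0)))" for k
    have card: "card (J - {j}) = i"
      using J j by (simp add: m_def)
    have "(\<integral>s. ?\<Phi> s * F (s j) s \<partial>?K) = (\<integral>s. (\<Prod>k\<in>J. q k (s k, restrict s {1..n})) \<partial>?K)"
    proof (intro Bochner_Integration.integral_cong refl)
      fix s
      have "(\<Prod>k\<in>J - {j}. q k (s k, restrict s {1..n})) = (\<Prod>k\<in>J - {j}. of_bool (F (s k) s \<ge> 0))"
        by (intro prod.cong refl) (auto simp: q_def F_restrict simp del: One_nat_def)
      then show "?\<Phi> s * F (s j) s = (\<Prod>k\<in>J. q k (s k, restrict s {1..n}))"
        unfolding prod.remove[OF J(1) j] by (simp add: q_def F_restrict del: One_nat_def)
    qed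
    also have "\<dots> = (\<integral>s. (\<Prod>k\<in>J. \<integral>x. q k (x, s) \<partial>?M) \<partial>?L)"
      using F F0 bounded_measurable_mult[OF F0 F]
      by (intro integral_PiM_conditional_prod M.prob_space_axioms) (auto simp: J_def q_def)
    also have "\<dots> = (\<integral>s. nonneg_mass w s ^ i * positive_part_mean w s \<partial>?L)"
    proof (intro Bochner_Integration.integral_cong refl)
      fix s
      have "(\<Prod>k\<in>J - {j}. \<integral>x. q k (x, s) \<partial>?M) = (\<Prod>k\<in>J - {j}. nonneg_mass w s)"
        by (intro prod.cong refl) (auto simp: q_def nonneg_mass_def)
      then show "(\<Prod>k\<in>J. \<integral>x. q k (x, s) \<partial>?M) = nonneg_mass w s ^ i * positive_part_mean w s"
        unfolding prod.remove[OF J(1) j] by (simp add: q_def positive_part_mean_def card)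
    qed
    finally show ?thesis .
  qed
  note int = bounded_measurable_integrable[OF bounded_measurable_mult[OF \<Phi> FK] K.prob_space_axioms]
  have "test m s = real (n + m) * (?\<Phi> s * F (s (n + m + 1)) s) - (\<Sum>j\<in>J. ?\<Phi> s * F (s j) s)" for s
    unfolding test_def J_def by (simp add: sum_distrib_left right_diff_distrib mult.left_commute)
  then have "(\<integral>s. test m s \<partial>?K) =
    (\<integral>s. real (n + m) * (?\<Phi> s * F (s (n + m + 1)) s) - (\<Sum>j\<in>J. ?\<Phi> s * F (s j) s) \<partial>?K)"
    by simp
  also have "\<dots> = (\<integral>s. real (n + m) * (?\<Phi> s * F (s (n + m + 1)) s) \<partial>?K)
    - (\<integral>s. (\<Sum>j\<in>J. ?\<Phi> s * F (s j) s) \<partial>?K)"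
    by (intro Bochner_Integration.integral_diff Bochner_Integration.integrable_sum
        integrable_mult_right int) (auto simp: J_def)
  also have "(\<integral>s. (\<Sum>j\<in>J. ?\<Phi> s * F (s j) s) \<partial>?K) = (\<Sum>j\<in>J. \<integral>s. ?\<Phi> s * F (s j) s \<partial>?K)"
    by (intro Bochner_Integration.integral_sum int) (auto simp: J_def)
  also have "\<dots> = real m * (\<integral>s. nonneg_mass w s ^ i * positive_part_mean w s \<partial>?L)"
    using 2 J by simp
  also have "(\<integral>s. real (n + m) * (?\<Phi> s * F (s (n + m + 1)) s) \<partial>?K) =
    real (n + m) * (\<integral>s. nonneg_mass w s ^ m * mean w s \<partial>?L)"
    unfolding 1[symmetric] by (rule integral_mult_right_zero)
  also have "real (n + m) * (\<integral>s. nonneg_mass w s ^ m * mean w s \<partial>?L)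
      - real m * (\<integral>s. nonneg_mass w s ^ i * positive_part_mean w s \<partial>?L) =
    (\<integral>s. moment_difference i w s \<partial>?L)"
  proof -
    note pw = bounded_measurable_power[OF bounded_measurable_nonneg_mass[OF w]]
    note pe = bounded_measurable_integrable[OF bounded_measurable_mult[OF
          pw bounded_measurable_mean[OF w]] L.prob_space_axioms, of m]
    note pa = bounded_measurable_integrable[OF bounded_measurable_mult[OF
          pw bounded_measurable_positive_part_mean[OF w]] L.prob_space_axioms, of i]
    have "(\<integral>s. moment_difference i w s \<partial>?L) =
      (\<integral>s. real (n + m) * (nonneg_mass w s ^ m * mean w s)
        - real m * (nonneg_mass w s ^ i * positive_part_mean w s) \<partial>?L)"
      unfolding moment_difference_def m_def by (simp only: mult.assoc)
    also have "\<dots> = real (n + m) * (\<integral>s. nonneg_mass w s ^ m * mean w s \<partial>?L)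
      - real m * (\<integral>s. nonneg_mass w s ^ i * positive_part_mean w s \<partial>?L)"
      by (subst Bochner_Integration.integral_diff) (simp_all add: pe pa del: power_Suc One_nat_def)
    finally show ?thesis ..
  qed
  finally show ?thesis
    unfolding m_def .
qed

section \<open>The limit of many replicas\<close>

lemma mass_and_mean_bounds:
  assumes w: "w \<in> space P" and s: "s \<in> space (\<Pi>\<^sub>M i\<in>{1..n}. G w)"
    and C: "\<And>x. x \<in> space (G w) \<Longrightarrow> \<bar>F x s\<bar> \<le> C" "C \<ge> 0"
  shows "0 \<le> nonneg_mass w s" "nonneg_mass w s \<le> 1" "\<bar>mean w s\<bar> \<le> C"
    "\<bar>positive_part_mean w s\<bar> \<le> C" "\<bar>mean w s - positive_part_mean w s\<bar> \<le> C * (1 - nonneg_mass w s)"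
proof -
  interpret M: prob_space "G w" by (rule prob_space_G[OF w])
  have F: "bounded_measurable (G w) (\<lambda>x. F x s)"
    using bounded_measurable_compose[OF bounded_measurable_F_replicas[OF w] measurable_Pair2'[OF s]]
    by simp
  note F0 = bounded_measurable_of_bool_nonneg[OF F]
  note int = bounded_measurable_integrable[OF _ M.prob_space_axioms]
  have bound: "\<bar>\<integral>x. \<phi> x \<partial>G w\<bar> \<le> (\<integral>x. \<psi> x \<partial>G w)"
    if "bounded_measurable (G w) \<phi>" "bounded_measurable (G w) \<psi>"
      "\<And>x. x \<in> space (G w) \<Longrightarrow> \<bar>\<phi> x\<bar> \<le> \<psi> x" for \<phi> \<psi> :: "'h \<Rightarrow> real"
    using that by (intro order_trans[OF integral_abs_bound] integral_mono integrable_abs int)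
  show "0 \<le> nonneg_mass w s"
    unfolding nonneg_mass_def by (intro Bochner_Integration.integral_nonneg) auto
  show "nonneg_mass w s \<le> 1"
    using bound[OF F0 bounded_measurable_const[of _ 1]] unfolding nonneg_mass_def
    by (simp add: M.prob_space)
  show "\<bar>mean w s\<bar> \<le> C"
    using bound[OF F bounded_measurable_const[of _ C]] C unfolding mean_def
    by (simp add: M.prob_space)
  show "\<bar>positive_part_mean w s\<bar> \<le> C"
    unfolding positive_part_mean_def using C
    by (intro order_trans[OF bound[OF bounded_measurable_mult[OF F0 F] bounded_measurable_const[of _ C]]])
       (use C in \<open>auto simp: M.prob_space abs_le_iff\<close>)
  have "\<bar>mean w s - positive_part_mean w s\<bar> = \<bar>\<integral>x. F x s - of_bool (F x s \<ge> 0) * F x s \<partial>G w\<bar>"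
    unfolding mean_def positive_part_mean_def
    using int[OF F] int[OF bounded_measurable_mult[OF F0 F]] by simp
  also have "\<dots> \<le> (\<integral>x. C * (1 - of_bool (F x s \<ge> 0)) \<partial>G w)"
    by (intro bound bounded_measurable_diff bounded_measurable_mult F F0 bounded_measurable_const)
       (use C in \<open>auto simp: abs_le_iff\<close>)
  also have "\<dots> = C * (1 - nonneg_mass w s)"
    using int[OF F0] unfolding nonneg_mass_def by (simp add: M.prob_space)
  finally show "\<bar>mean w s - positive_part_mean w s\<bar> \<le> C * (1 - nonneg_mass w s)" .
qed

text \<open>The pointwise limit of \<open>moment_difference\<close>.\<close>

definition limit_difference :: "'w \<Rightarrow> (nat \<Rightarrow> 'h) \<Rightarrow> real" where
  "limit_difference w s = (if nonneg_mass w s = 1 then real n * mean w s else 0)"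

text \<open>
  Dominated convergence is applied twice, to the integral over the replicas for fixed \<open>G\<close> and then to the
  expectation, so that joint measurability in \<open>w\<close> and \<open>s\<close> is not needed. Measurability in \<open>w\<close> is
  obtained from the integrals of \<open>test\<close> against the kernel \<open>G\<^sup>\<otimes>\<^sup>\<infinity>\<close>.
\<close>

lemma F_nonneg_imp_F_eq_0:
  "AE w in P. AE s in (\<Pi>\<^sub>M i\<in>{1..n}. G w).
    (AE x in G w. F x s \<ge> 0) \<longrightarrow> (AE x in G w. F x s = 0)"
proof -
  obtain C where C: "C \<ge> 0"
    "\<And>z. z \<in> space (unit_ball_borel \<Otimes>\<^sub>M (\<Pi>\<^sub>M i\<in>{1..n}. unit_ball_borel)) \<Longrightarrow> \<bar>F (fst z) (snd z)\<bar> \<le> C"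
    using bounded_measurable_bound[OF bounded_measurable_F] by metis
  have FC: "\<bar>F x s\<bar> \<le> C" if "w \<in> space P" "x \<in> space (G w)" "s \<in> space (\<Pi>\<^sub>M i\<in>{1..n}. G w)" for w x s
  proof -
    have "space (G w) = space unit_ball_borel"
      by (rule sets_eq_imp_space_eq[OF sets_G[OF that(1)]])
    then show ?thesis
      using that C(2)[of "(x, s)"] by (simp add: space_pair_measure space_PiM)
  qed
  let ?L = "\<lambda>w. \<Pi>\<^sub>M i\<in>{1..n}. G w"
  have L: "prob_space (?L w)" if "w \<in> space P" for w
    by (rule prob_space_PiM[OF prob_space_G[OF that]])
  note bounds = mass_and_mean_bounds[OF _ _ FC C(1)]
  define D where "D i w = (\<integral>s. moment_difference i w s \<partial>?L w)" for i w
  define D_lim where "D_lim w = (\<integral>s. limit_difference w s \<partial>?L w)" for w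
  have lim_measurable: "limit_difference w \<in> borel_measurable (?L w)" if "w \<in> space P" for w
  proof -
    note [measurable] = bounded_measurable_nonneg_mass[OF that] bounded_measurable_mean[OF that]
    show ?thesis unfolding limit_difference_def by measurable
  qed
  have md_bound: "\<bar>moment_difference i w s\<bar> \<le> (real n + 2) * C"
    if "w \<in> space P" "s \<in> space (?L w)" for i w s
    unfolding moment_difference_def using bounds[OF that that(1) _ that(2)]
    by (intro moment_difference_bound) auto
  have lim_w: "(\<lambda>i. D i w) \<longlonglongrightarrow> D_lim w" if w: "w \<in> space P" for w
    unfolding D_def D_lim_def
  proof (rule integral_dominated_convergence[where w="\<lambda>_. (real n + 2) * C"])
    interpret L: prob_space "?L w" by (rule L[OF w])
    show "integrable (?L w) (\<lambda>_. (real n + 2) * C)" by (rule L.integrable_const)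
    show "AE s in ?L w. (\<lambda>i. moment_difference i w s) \<longlonglongrightarrow> limit_difference w s"
      unfolding moment_difference_def limit_difference_def
      using bounds[OF w _ w] by (intro AE_I2 moment_difference_tendsto) auto
    show "AE s in ?L w. norm (moment_difference i w s) \<le> (real n + 2) * C" for i
      using md_bound[OF w] by auto
  qed (use lim_measurable[OF w] bounded_measurable_moment_difference[OF w] in
      \<open>auto dest: bounded_measurable_measurable\<close>)
  have D_measurable: "D i \<in> borel_measurable P" for i
  proof -
    have "(\<lambda>w. \<integral>s. test (Suc i) s \<partial>(\<Pi>\<^sub>M i\<in>{1..}. G w)) \<in> borel_measurable P"
      by (intro measurable_compose[OF measurable_prob_algebraD[OF replicas_measurable]]
          integral_measurable_subprob_algebra bounded_measurable_measurable bounded_measurable_test)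
    also have "?this \<longleftrightarrow> ?thesis"
      unfolding D_def by (intro measurable_cong integral_test_replicas)
    finally show ?thesis .
  qed
  have D_lim_measurable: "D_lim \<in> borel_measurable P"
    by (rule borel_measurable_LIMSEQ_real[OF lim_w D_measurable])
  have D_bound: "\<bar>D i w\<bar> \<le> (real n + 2) * C" if w: "w \<in> space P" for i w
  proof -
    interpret L: prob_space "?L w" by (rule L[OF w])
    have int: "integrable (?L w) (moment_difference i w)"
      by (rule bounded_measurable_integrable[OF bounded_measurable_moment_difference[OF w] L[OF w]])
    have "\<bar>D i w\<bar> \<le> (\<integral>s. \<bar>moment_difference i w s\<bar> \<partial>?L w)"
      unfolding D_def by (rule integral_abs_bound)
    also have "\<dots> \<le> (\<integral>s. (real n + 2) * C \<partial>?L w)"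
      using md_bound[OF w] by (intro integral_mono integrable_abs int L.integrable_const)
    finally show ?thesis
      by (simp add: L.prob_space del: One_nat_def)
  qed
  have "(\<lambda>i. \<integral>w. D i w \<partial>P) \<longlonglongrightarrow> (\<integral>w. D_lim w \<partial>P)"
    using lim_w D_bound
    by (intro integral_dominated_convergence[where w="\<lambda>_. (real n + 2) * C"] D_measurable D_lim_measurable)
       auto
  moreover have "(\<integral>w. D i w \<partial>P) = 0" for i
  proof -
    have "(\<integral>w. D i w \<partial>P) = (\<integral>w. (\<integral>s. test (Suc i) s \<partial>(\<Pi>\<^sub>M i\<in>{1..}. G w)) \<partial>P)"
      unfolding D_def by (intro Bochner_Integration.integral_cong refl integral_test_replicas[symmetric])
    then show ?thesis
      using integral_test by simp
  qed
  ultimately have int_D_lim: "(\<integral>w. D_lim w \<partial>P) = 0"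
    by (simp add: LIMSEQ_const_iff)

  have mass_1: "nonneg_mass w s = 1 \<longleftrightarrow> (AE x in G w. F x s \<ge> 0)"
    and mean_0: "nonneg_mass w s = 1 \<Longrightarrow> mean w s \<ge> 0"
      "nonneg_mass w s = 1 \<Longrightarrow> mean w s = 0 \<longleftrightarrow> (AE x in G w. F x s = 0)"
    if w: "w \<in> space P" and s: "s \<in> space (?L w)" for w s
  proof -
    interpret M: prob_space "G w" by (rule prob_space_G[OF w])
    have F: "bounded_measurable (G w) (\<lambda>x. F x s)"
      using bounded_measurable_compose[OF bounded_measurable_F_replicas[OF w] measurable_Pair2'[OF s]]
      by simp
    note [measurable] = F
    have "nonneg_mass w s = M.prob {x \<in> space (G w). F x s \<ge> 0}"
    proof -
      have "nonneg_mass w s = (\<integral>x. indicator {x \<in> space (G w). F x s \<ge> 0} x \<partial>G w)"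
        unfolding nonneg_mass_def
        by (intro Bochner_Integration.integral_cong) (auto simp: indicator_def)
      then show ?thesis by simp
    qed
    then show *: "nonneg_mass w s = 1 \<longleftrightarrow> (AE x in G w. F x s \<ge> 0)"
      using M.prob_Collect_eq_1[of "\<lambda>x. F x s \<ge> 0"] by simp
    assume "nonneg_mass w s = 1"
    with * have ae: "AE x in G w. F x s \<ge> 0" by simp
    then show "mean w s \<ge> 0"
      unfolding mean_def by (rule integral_nonneg_AE)
    show "mean w s = 0 \<longleftrightarrow> (AE x in G w. F x s = 0)"
      unfolding mean_def
      by (rule integral_nonneg_eq_0_iff_AE[OF bounded_measurable_integrable[OF F M.prob_space_axioms] ae])
  qed
  have lim_nonneg: "limit_difference w s \<ge> 0" if "w \<in> space P" "s \<in> space (?L w)" for w s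
    using mean_0(1)[OF that] by (simp add: limit_difference_def)
  have lim_bound: "\<bar>limit_difference w s\<bar> \<le> real n * C" if "w \<in> space P" "s \<in> space (?L w)" for w s
    using bounds(3)[OF that that(1) _ that(2)] C(1)
    by (auto simp: limit_difference_def abs_mult intro: mult_left_mono)
  have lim_integrable: "integrable (?L w) (limit_difference w)" if "w \<in> space P" for w
    using lim_bound[OF that] lim_measurable[OF that]
    by (intro bounded_measurable_integrable[OF bounded_measurableI L] that) auto
  have "integrable P D_lim"
  proof (rule integrable_const_bound[of _ "(real n + 2) * C"])
    have "\<bar>D_lim w\<bar> \<le> (real n + 2) * C" if "w \<in> space P" for w
      using tendsto_rabs[OF lim_w[OF that]] D_bound[OF that] by (intro LIMSEQ_le_const2) auto
    then show "AE w in P. norm (D_lim w) \<le> (real n + 2) * C"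
      by auto
  qed (rule D_lim_measurable)
  moreover have "AE w in P. D_lim w \<ge> 0"
    unfolding D_lim_def using lim_nonneg by (intro AE_I2 integral_nonneg_AE) auto
  ultimately have D_lim_0: "AE w in P. D_lim w = 0"
    using int_D_lim integral_nonneg_eq_0_iff_AE by blast
  show ?thesis
  proof (rule AE_mp[OF D_lim_0], rule AE_I2, rule impI)
    fix w assume w: "w \<in> space P" and "D_lim w = 0"
    moreover have "AE s in ?L w. limit_difference w s \<ge> 0"
      using lim_nonneg[OF w] by auto
    ultimately have lim_0: "AE s in ?L w. limit_difference w s = 0"
      unfolding D_lim_def using integral_nonneg_eq_0_iff_AE[OF lim_integrable[OF w]] by blast
    show "AE s in ?L w. (AE x in G w. F x s \<ge> 0) \<longrightarrow> (AE x in G w. F x s = 0)"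
    proof (rule AE_mp[OF lim_0], rule AE_I2, rule impI)
      fix s assume s: "s \<in> space (?L w)" and "limit_difference w s = 0"
      with mass_1[OF w s] mean_0(2)[OF w s] n
      show "(AE x in G w. F x s \<ge> 0) \<longrightarrow> (AE x in G w. F x s = 0)"
        by (auto simp: limit_difference_def split: if_splits)
    qed
  qed
qed

end

section \<open>Sign balance of \<open>F_bar\<close>\<close>

theorem theorem3:
  fixes P :: "'w measure"
    and G :: "'w \<Rightarrow> 'h::{real_inner, complete_space, second_countable_topology} measure"
    and n :: nat
    and f :: "nat \<Rightarrow> (nat \<times> nat \<Rightarrow> real) \<times> real \<Rightarrow> real"
  assumes "random_prob_measure P G"
    and "ghirlanda_guerra P G"
    and "n \<ge> 1"
    and "\<And>l. l \<in> {1..n} \<Longrightarrow> bounded_measurable (real_arrays (pairs n) \<Otimes>\<^sub>M borel) (f l)"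
  shows "AE w in P. AE s in (\<Pi>\<^sub>M i\<in>{1..n}. G w).
    (let F = (\<lambda>x. F_bar (overlap_law P G) n f x s) in
      ((measure (G w) {x \<in> space (G w). F x > 0} > 0 \<and>
        measure (G w) {x \<in> space (G w). F x < 0} > 0) \<or>
       (measure (G w) {x \<in> space (G w). F x > 0} = 0 \<and>
        measure (G w) {x \<in> space (G w). F x < 0} = 0)) \<and>
      measure (G w) {x \<in> space (G w). F x \<ge> 0} > 0 \<and>
      measure (G w) {x \<in> space (G w). F x \<le> 0} > 0)"
proof -
  let ?f' = "\<lambda>l z. - f l z"
  interpret pos: cavity_functions P G n f
    by unfold_locales (fact assms)+
  interpret neg: cavity_functions P G n ?f'
    by unfold_locales (auto intro!: assms bounded_measurable_minus simp del: One_nat_def)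
  \<comment> \<open>\<open>F_bar\<close> is odd in the functions \<open>f\<^sub>l\<close>, which exchanges the two inequalities.\<close>
  have minus: "F_bar (overlap_law P G) n ?f' x s = - F_bar (overlap_law P G) n f x s" for x and s :: "nat \<Rightarrow> 'h"
    unfolding F_bar_def F_repl_def F_sum_def
    by (simp add: sum_negf sum_subtractf sum.distrib algebra_simps diff_divide_distrib add_divide_distrib)
  have imp: "AE w in P. AE s in (\<Pi>\<^sub>M i\<in>{1..n}. G w).
    ((AE x in G w. pos.F x s \<ge> 0) \<longrightarrow> (AE x in G w. pos.F x s = 0)) \<and>
    ((AE x in G w. pos.F x s \<le> 0) \<longrightarrow> (AE x in G w. pos.F x s = 0))"
    using pos.F_nonneg_imp_F_eq_0 neg.F_nonneg_imp_F_eq_0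
    unfolding AE_conj_iff minus neg_0_le_iff_le neg_equal_0_iff_equal by (rule conjI)
  show ?thesis
  proof (rule AE_mp[OF imp], rule AE_I2, rule impI)
    fix w assume w: "w \<in> space P" and
      ae: "AE s in (\<Pi>\<^sub>M i\<in>{1..n}. G w).
        ((AE x in G w. pos.F x s \<ge> 0) \<longrightarrow> (AE x in G w. pos.F x s = 0)) \<and>
        ((AE x in G w. pos.F x s \<le> 0) \<longrightarrow> (AE x in G w. pos.F x s = 0))"
    interpret M: prob_space "G w" by (rule pos.prob_space_G[OF w])
    show "AE s in (\<Pi>\<^sub>M i\<in>{1..n}. G w).
      (let F = (\<lambda>x. F_bar (overlap_law P G) n f x s) in
        ((M.prob {x \<in> space (G w). F x > 0} > 0 \<and> M.prob {x \<in> space (G w). F x < 0} > 0) \<or>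
         (M.prob {x \<in> space (G w). F x > 0} = 0 \<and> M.prob {x \<in> space (G w). F x < 0} = 0)) \<and>
        M.prob {x \<in> space (G w). F x \<ge> 0} > 0 \<and> M.prob {x \<in> space (G w). F x \<le> 0} > 0)"
    proof (rule AE_mp[OF ae], rule AE_I2, rule impI)
      fix s assume s: "s \<in> space (\<Pi>\<^sub>M i\<in>{1..n}. G w)"
        and imp: "((AE x in G w. pos.F x s \<ge> 0) \<longrightarrow> (AE x in G w. pos.F x s = 0)) \<and>
          ((AE x in G w. pos.F x s \<le> 0) \<longrightarrow> (AE x in G w. pos.F x s = 0))"
      have "bounded_measurable (G w) (\<lambda>x. pos.F x s)"
        using bounded_measurable_compose[OF pos.bounded_measurable_F_replicas[OF w] measurable_Pair2'[OF s]]
        by simp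
      note [measurable] = this
      have pred: "Measurable.pred (G w) (\<lambda>x. pos.F x s > 0)" "Measurable.pred (G w) (\<lambda>x. pos.F x s < 0)"
        "Measurable.pred (G w) (\<lambda>x. pos.F x s \<ge> 0)" "Measurable.pred (G w) (\<lambda>x. pos.F x s \<le> 0)"
        by measurable
      have pos: "M.prob {x \<in> space (G w). Q x} > 0 \<longleftrightarrow> \<not> (AE x in G w. \<not> Q x)"
        if "Measurable.pred (G w) Q" for Q
        using M.prob_Collect_eq_0[OF that[unfolded pred_def]] measure_nonneg[of "G w" "{x \<in> space (G w). Q x}"]
        by linarith
      have eq0: "M.prob {x \<in> space (G w). Q x} = 0 \<longleftrightarrow> (AE x in G w. \<not> Q x)"
        if "Measurable.pred (G w) Q" for Q
        using M.prob_Collect_eq_0[OF that[unfolded pred_def]] .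
      have "\<not> (AE x in G w. pos.F x s < 0)"
      proof
        assume ae: "AE x in G w. pos.F x s < 0"
        then have "AE x in G w. pos.F x s \<le> 0" by eventually_elim simp
        with imp have "AE x in G w. pos.F x s = 0" by blast
        with ae have "AE x in G w. False" by eventually_elim simp
        then show False by simp
      qed
      moreover have "\<not> (AE x in G w. pos.F x s > 0)"
      proof
        assume ae: "AE x in G w. pos.F x s > 0"
        then have "AE x in G w. pos.F x s \<ge> 0" by eventually_elim simp
        with imp have "AE x in G w. pos.F x s = 0" by blast
        with ae have "AE x in G w. False" by eventually_elim simp
        then show False by simp
      qed
      moreover have "(AE x in G w. pos.F x s \<le> 0) \<longleftrightarrow> (AE x in G w. pos.F x s \<ge> 0)"
      proof
        assume "AE x in G w. pos.F x s \<le> 0"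
        with imp have "AE x in G w. pos.F x s = 0" by blast
        then show "AE x in G w. pos.F x s \<ge> 0" by eventually_elim simp
      next
        assume "AE x in G w. pos.F x s \<ge> 0"
        with imp have "AE x in G w. pos.F x s = 0" by blast
        then show "AE x in G w. pos.F x s \<le> 0" by eventually_elim simp
      qed
      ultimately show "let F = (\<lambda>x. F_bar (overlap_law P G) n f x s) in
        ((M.prob {x \<in> space (G w). F x > 0} > 0 \<and> M.prob {x \<in> space (G w). F x < 0} > 0) \<or>
         (M.prob {x \<in> space (G w). F x > 0} = 0 \<and> M.prob {x \<in> space (G w). F x < 0} = 0)) \<and>
        M.prob {x \<in> space (G w). F x \<ge> 0} > 0 \<and> M.prob {x \<in> space (G w). F x \<le> 0} > 0"
        unfolding Let_def pos[OF pred(1)] pos[OF pred(2)] pos[OF pred(3)] pos[OF pred(4)]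
          eq0[OF pred(1)] eq0[OF pred(2)] not_less not_le by blast
    qed
  qed
qed

end
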